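(* Let $H$, $A$, $A_1,\dots,A_m$, $\eta_1,\dots,\eta_m$, $M$, $f$, $\varphi_0,\varphi_1$, $T$ and the scheme values $v_k$ be as described in the context, and suppose the Cauchy problem $$u''(t)+Au(t)+M(u(t))=f(t),\quad t\in[0,T],\qquad u(0)=\varphi_0,\quad u'(0)=\varphi_1$$ has a solution $u$. If the functions $f(t)$ and $A^{1/2}u(t)$ satisfy on $[0,T]$ a Hölder condition with index $\lambda$ ($0<\lambda\le1$), then there is a constant $c>0$, independent of $n$ (equivalently of $\tau=T/n$) and of $k$, such that $$\|u(t_k)-v_k\|\le c\,\tau^\lambda,\qquad k=0,1,\dots,n.$$
   Context: $H$ is a Hilbert space with norm $\|\cdot\|$ and inner product $(\cdot,\cdot)$. $A$ is a self-adjoint, positive definite (generally unbounded) operator with dense domain $D(A)\subset H$: $A=A^*$ and $(Au,u)\ge\alpha\|u\|^2$ for all $u\in D(A)$, with a constant $\alpha>0$. Moreover $A=\sum_{j=1}^mA_j$ as unbounded operators (so $D(A)=\bigcap_jD(A_j)$), where each $A_j=A_j^*\ge\alpha_jI$ with constant $\alpha_j>0$. The nonlinear operator $M:H\to H$ satisfies $\|M(u)-M(v)\|\le a\|u-v\|$ for all $u,v\in H$, with a constant $a>0$. $f:[0,T]\to H$ is a given continuous function, $T>0$, and $\varphi_0,\varphi_1\in H$ are given vectors. A solution of the Cauchy problem is a function $u:[0,T]\to H$ such that (a) $u$ is twice continuously differentiable on $[0,T]$; (b) $u(t)\in D(A)$ for all $t\in[0,T]$, and $Au(t)$ and $M(u(t))$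 are continuous in $t$; (c) $u$ satisfies the equation on $[0,T]$ and the initial conditions. Scheme: fix weights $\eta_j$ with $0<\eta_j<1$, $\sum_{j=1}^m\eta_j=1$. For an integer $n>1$ let $\tau=T/n$, $t_k=k\tau$. Set $v_0=\varphi_0$, $v_1=\varphi_0+\tau\varphi_1$, and for $k=1,\dots,n-1$ set $v_{k+1}=\sum_{j=1}^m\eta_jy_{j,k+1}$, where $y_{j,k+1}$ ($j=1,\dots,m$) solves $$\eta_j\frac{y_{j,k+1}-2v_k+v_{k-1}}{\tau^2}+A_jy_{j,k+1}=\delta_{1,j}\left[f(t_k)-M(v_k)\right],$$ with $\delta_{1,j}$ the Kronecker symbol. An $H$-valued function $w$ satisfies a Hölder condition with index $\lambda$ on $[0,T]$ if $\|w(t)-w(s)\|\le C|t-s|^\lambda$ for all $s,t\in[0,T]$ and some constant $C$. *)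

theory Defs
  imports "HOL-Analysis.Analysis"
begin

text \<open>
  An unbounded operator on a Hilbert space is given by its domain \<open>D\<close> together with a function
  \<open>A\<close>; the values of \<open>A\<close> outside \<open>D\<close> are irrelevant and are never referred to.

  Hilbert spaces are taken over the reals. This includes the complex case: a complex Hilbert space
  with the inner product \<open>Re (x, y)\<close> is a real Hilbert space with the same norm, and the
  adjoint, self-adjointness, lower bounds and the positive square root of a complex linear operator
  are the same for both inner products.
\<close>

definition linear_operator :: "'a::real_vector set \<Rightarrow> ('a \<Rightarrow> 'a) \<Rightarrow> bool" where
  "linear_operator D A \<longleftrightarrow> subspace D \<and>
     (\<forall>x\<in>D. \<forall>y\<in>D. A (x + y) = A x + A y) \<and>
     (\<forall>r. \<forall>x\<in>D. A (r *\<^sub>R x) = r *\<^sub>R A x)"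

text \<open>For dense \<open>D\<close> this relation is single-valued, i.e. it is the graph of an operator.\<close>

definition adjoint_graph :: "'a::real_inner set \<Rightarrow> ('a \<Rightarrow> 'a) \<Rightarrow> ('a \<times> 'a) set" where
  "adjoint_graph D A = {(y, z). \<forall>x\<in>D. A x \<bullet> y = x \<bullet> z}"

text \<open>Equality of the graphs includes equality of the domains of \<open>A\<close> and its adjoint.\<close>

definition self_adjoint_operator :: "'a::real_inner set \<Rightarrow> ('a \<Rightarrow> 'a) \<Rightarrow> bool" where
  "self_adjoint_operator D A \<longleftrightarrow> linear_operator D A \<and> closure D = UNIV \<and>
     adjoint_graph D A = {(x, A x) | x. x \<in> D}"

definition bounded_below_by :: "real \<Rightarrow> 'a::real_inner set \<Rightarrow> ('a \<Rightarrow> 'a) \<Rightarrow> bool" where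
  "bounded_below_by \<alpha> D A \<longleftrightarrow> (\<forall>x\<in>D. A x \<bullet> x \<ge> \<alpha> * (norm x)\<^sup>2)"

text \<open>
  \<open>(E, B)\<close> is the square root of \<open>(D, A)\<close>: the (unique) nonnegative self-adjoint operator
  whose square, with its natural domain, is \<open>(D, A)\<close>.
\<close>

definition is_operator_sqrt ::
  "'a::real_inner set \<Rightarrow> ('a \<Rightarrow> 'a) \<Rightarrow> 'a set \<Rightarrow> ('a \<Rightarrow> 'a) \<Rightarrow> bool" where
  "is_operator_sqrt E B D A \<longleftrightarrow> self_adjoint_operator E B \<and> bounded_below_by 0 E B \<and>
     D = {x\<in>E. B x \<in> E} \<and> (\<forall>x\<in>D. B (B x) = A x)"

definition is_operator_sum ::
  "'a::real_vector set \<Rightarrow> ('a \<Rightarrow> 'a) \<Rightarrow> 'i set \<Rightarrow> ('i \<Rightarrow> 'a set) \<Rightarrow> ('i \<Rightarrow> 'a \<Rightarrow> 'a) \<Rightarrow> bool" where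
  "is_operator_sum D A J Ds As \<longleftrightarrow>
     D = (\<Inter>j\<in>J. Ds j) \<and> (\<forall>x\<in>D. A x = (\<Sum>j\<in>J. As j x))"

definition holder_on :: "real \<Rightarrow> real set \<Rightarrow> (real \<Rightarrow> 'a::real_normed_vector) \<Rightarrow> bool" where
  "holder_on \<nu> S w \<longleftrightarrow> (\<exists>C. \<forall>t\<in>S. \<forall>s\<in>S. norm (w t - w s) \<le> C * \<bar>t - s\<bar> powr \<nu>)"

text \<open>
  Solutions of \<open>u'' + A u + M u = f\<close>, \<open>u(0) = \<phi>0\<close>, \<open>u'(0) = \<phi>1\<close> on
  \<open>[0, T]\<close>; derivatives at the end points are one-sided.
\<close>

definition cauchy_solution ::
  "'a::real_inner set \<Rightarrow> ('a \<Rightarrow> 'a) \<Rightarrow> ('a \<Rightarrow> 'a) \<Rightarrow> (real \<Rightarrow> 'a) \<Rightarrow> real \<Rightarrow> 'a \<Rightarrow> 'a \<Rightarrow>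
   (real \<Rightarrow> 'a) \<Rightarrow> bool" where
  "cauchy_solution D A M f T \<phi>0 \<phi>1 u \<longleftrightarrow>
     (\<exists>u' u''.
        (\<forall>t\<in>{0..T}. (u has_vector_derivative u' t) (at t within {0..T})) \<and>
        (\<forall>t\<in>{0..T}. (u' has_vector_derivative u'' t) (at t within {0..T})) \<and>
        continuous_on {0..T} u'' \<and>
        (\<forall>t\<in>{0..T}. u t \<in> D) \<and>
        continuous_on {0..T} (\<lambda>t. A (u t)) \<and>
        continuous_on {0..T} (\<lambda>t. M (u t)) \<and>
        (\<forall>t\<in>{0..T}. u'' t + A (u t) + M (u t) = f t) \<and>
        u 0 = \<phi>0 \<and> u' 0 = \<phi>1)"

text \<open>
  \<open>v k\<close> and \<open>y j k\<close> are produced by \<open>n\<close> steps of the scheme with time step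
  \<open>T / n\<close>; only \<open>v 0, ..., v n\<close> and \<open>y j 2, ..., y j n\<close> with \<open>1 \<le> j \<le> m\<close> are
  constrained.
\<close>

definition decomposition_scheme ::
  "nat \<Rightarrow> (nat \<Rightarrow> 'a::real_inner set) \<Rightarrow> (nat \<Rightarrow> 'a \<Rightarrow> 'a) \<Rightarrow> (nat \<Rightarrow> real) \<Rightarrow> ('a \<Rightarrow> 'a) \<Rightarrow>
   (real \<Rightarrow> 'a) \<Rightarrow> real \<Rightarrow> 'a \<Rightarrow> 'a \<Rightarrow> nat \<Rightarrow> (nat \<Rightarrow> 'a) \<Rightarrow> (nat \<Rightarrow> nat \<Rightarrow> 'a) \<Rightarrow> bool" where
  "decomposition_scheme m Ds As \<eta> M f T \<phi>0 \<phi>1 n v y \<longleftrightarrow>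
     (let \<tau> = T / real n in
        v 0 = \<phi>0 \<and> v 1 = \<phi>0 + \<tau> *\<^sub>R \<phi>1 \<and>
        (\<forall>k\<in>{1..n - 1}.
           (\<forall>j\<in>{1..m}. y j (k + 1) \<in> Ds j \<and>
              \<eta> j *\<^sub>R ((y j (k + 1) - 2 *\<^sub>R v k + v (k - 1)) /\<^sub>R \<tau>\<^sup>2) + As j (y j (k + 1)) =
                (if j = 1 then f (real k * \<tau>) - M (v k) else 0)) \<and>
           v (k + 1) = (\<Sum>j = 1..m. \<eta> j *\<^sub>R y j (k + 1))))"

end

theory Submission imports Defs begin

text \<open>
  With the resolvents \<open>R\<^sub>j = (I + \<tau>\<^sup>2 / \<eta>\<^sub>j A\<^sub>j)\<^sup>-\<^sup>1\<close> and \<open>P = \<Sum>\<^sub>j \<eta>\<^sub>j (I - R\<^sub>j)\<close> the errors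
  \<open>z\<^sub>k = u(t\<^sub>k) - v\<^sub>k\<close> satisfy
  \<open>z\<^sub>k\<^sub>+\<^sub>1 - 2 z\<^sub>k + z\<^sub>k\<^sub>-\<^sub>1 + P (2 z\<^sub>k - z\<^sub>k\<^sub>-\<^sub>1) = g\<^sub>k\<close>, where \<open>c \<tau>\<^sup>2 I \<le> P \<le> I\<close>
  and \<open>P \<le> \<tau>\<^sup>2 A\<close> as quadratic forms. Testing with \<open>P\<^sup>-\<^sup>1 (z\<^sub>k\<^sub>+\<^sub>1 - z\<^sub>k)\<close> shows that the
  root of an energy dominating \<open>\<parallel>z\<^sub>k\<parallel>\<^sup>2\<close> grows in each step by at most twice the norm of \<open>g\<^sub>k\<close>
  dual to \<open>(P y, y)\<^sup>1\<^sup>/\<^sup>2\<close>.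
  In this dual norm \<open>P x\<close> costs \<open>\<tau> \<parallel>A\<^sup>1\<^sup>/\<^sup>2 x\<parallel>\<close>, a term \<open>(I - R\<^sub>j) x\<close> costs \<open>\<parallel>x\<parallel>\<close> up to a
  constant, and an arbitrary \<open>x\<close> costs \<open>\<parallel>x\<parallel> / \<tau>\<close>. As \<open>P x = \<tau>\<^sup>2 \<Sum>\<^sub>j R\<^sub>j A\<^sub>j x\<close> on the domain of \<open>A\<close>,
  the residual splits into a term \<open>P\<close> of increments of \<open>u\<close>, terms \<open>\<tau>\<^sup>2 (I - R\<^sub>j) x\<close>
  with \<open>x\<close> bounded, and increments of \<open>f - M u\<close>; together these cost \<open>O(\<tau>\<^sup>1\<^sup>+\<^sup>\<nu>)\<close>, and the
  discrete Gronwall inequality absorbs the Lipschitz term.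
\<close>

section \<open>Nearest points in closed subspaces and testing on dense sets\<close>

section \<open>Orthogonality in Hilbert spaces\<close>

text \<open>The parallelogram law makes a minimizing sequence Cauchy; by completeness its limit is a
  nearest point of \<open>S\<close>, and at a nearest point the difference is orthogonal to
  \<open>S\<close>.\<close>

lemma orthogonal_projection_exists:
  fixes S :: "'a::{real_inner, complete_space} set"
  assumes S: "subspace S" "closed S"
  shows "\<exists>p\<in>S. \<forall>s\<in>S. (x - p) \<bullet> s = 0"
proof -
  define d where "d = infdist x S"
  have ne: "S \<noteq> {}" using subspace_0[OF S(1)] by auto
  have d_le: "d \<le> norm (x - s)" if "s \<in> S" for s
    using infdist_le[OF that, of x] by (simp add: d_def dist_norm)
  have d0: "d \<ge> 0" by (simp add: d_def infdist_nonneg)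
  have "\<exists>s\<in>S. norm (x - s) < d + 1 / Suc n" for n
  proof (rule ccontr)
    assume "\<not> ?thesis"
    then have "d + 1 / Suc n \<le> infdist x S"
      unfolding infdist_notempty[OF ne] using ne
      by (intro cINF_greatest) (auto simp: dist_norm not_less)
    then show False by (simp add: d_def)
  qed
  then obtain s where s: "\<And>n. s n \<in> S" "\<And>n. norm (x - s n) < d + 1 / Suc n" by metis
  have lim: "(\<lambda>n. norm (x - s n)) \<longlonglongrightarrow> d"
  proof (rule tendsto_sandwich[OF _ _ tendsto_const])
    show "(\<lambda>n. d + 1 / Suc n) \<longlonglongrightarrow> d"
      using tendsto_add[OF tendsto_const LIMSEQ_inverse_real_of_nat, of d]
      by (simp add: inverse_eq_divide)
  qed (use s d_le in \<open>auto intro!: always_eventually less_imp_le\<close>)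
  \<comment> \<open>The midpoint of two approximants lies in \<open>S\<close>, hence at distance at
    least \<open>d\<close> from \<open>x\<close>; this forces the approximants to be close.\<close>
  have par: "(dist (s m) (s n))\<^sup>2 \<le> 2 * (norm (x - s m))\<^sup>2 + 2 * (norm (x - s n))\<^sup>2 - 4 * d\<^sup>2" for m n
  proof -
    have "d \<le> norm (x - (1/2) *\<^sub>R (s m + s n))"
      using s S(1) by (intro d_le) (simp add: subspace_add subspace_scale)
    then have "4 * d\<^sup>2 \<le> 4 * (norm (x - (1/2) *\<^sub>R (s m + s n)))\<^sup>2"
      using d0 by (simp add: power_mono)
    also have "\<dots> = 2 * (norm (x - s m))\<^sup>2 + 2 * (norm (x - s n))\<^sup>2 - (dist (s m) (s n))\<^sup>2"
      by (simp add: dist_norm power2_norm_eq_inner inner_simps algebra_simps inner_commute)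
    finally show ?thesis by simp
  qed
  have "Cauchy s"
  proof (rule metric_CauchyI)
    fix e :: real assume e: "e > 0"
    have "(\<lambda>n. (norm (x - s n))\<^sup>2) \<longlonglongrightarrow> d\<^sup>2" using lim by (intro tendsto_power)
    moreover have "d\<^sup>2 < d\<^sup>2 + e\<^sup>2 / 4" using e by simp
    ultimately have "\<forall>\<^sub>F n in sequentially. (norm (x - s n))\<^sup>2 < d\<^sup>2 + e\<^sup>2 / 4"
      by (rule order_tendstoD(2))
    then obtain N where N: "\<And>n. n \<ge> N \<Longrightarrow> (norm (x - s n))\<^sup>2 < d\<^sup>2 + e\<^sup>2 / 4"
      by (auto simp: eventually_sequentially)
    have "dist (s m) (s n) < e" if "m \<ge> N" "n \<ge> N" for m n
    proof -
      have "(dist (s m) (s n))\<^sup>2 < e\<^sup>2" using par[of m n] N[OF that(1)] N[OF that(2)] by simp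
      then show ?thesis using e by (intro power2_less_imp_less[of _ e]) auto
    qed
    then show "\<exists>M. \<forall>m\<ge>M. \<forall>n\<ge>M. dist (s m) (s n) < e" by blast
  qed
  then obtain p where p: "s \<longlonglongrightarrow> p" using Cauchy_convergent convergent_def by blast
  have pS: "p \<in> S" using S(2) s(1) p closed_sequentially by blast
  have "(\<lambda>n. norm (x - s n)) \<longlonglongrightarrow> norm (x - p)"
    by (intro tendsto_intros p)
  then have npd: "norm (x - p) = d" using lim LIMSEQ_unique by blast
  have "(x - p) \<bullet> t = 0" if t: "t \<in> S" for t
  proof -
    \<comment> \<open>A nearest point of a convex set gives only a one-sided inequality; in a
      subspace it applies to \<open>t\<close> and to \<open>- t\<close>.\<close>
    have le: "(x - p) \<bullet> y \<le> 0" if y: "y \<in> S" for y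
      using any_closest_point_dot[OF subspace_imp_convex[OF S(1)] S(2) pS, of "p + y" x] y pS S(1) d_le npd
      by (simp add: subspace_add dist_norm)
    from le[OF t] le[OF subspace_neg[OF S(1) t]] show ?thesis by simp
  qed
  then show ?thesis using pS by blast
qed

lemma subspace_eq_UNIV_if_orthogonal_trivial:
  fixes S :: "'a::{real_inner, complete_space} set"
  assumes "subspace S" "closed S" "\<And>y. (\<And>s. s \<in> S \<Longrightarrow> s \<bullet> y = 0) \<Longrightarrow> y = 0"
  shows "S = UNIV"
proof -
  have "x \<in> S" for x
  proof -
    obtain p where p: "p \<in> S" "\<forall>s\<in>S. (x - p) \<bullet> s = 0"
      using orthogonal_projection_exists[OF assms(1,2)] by blast
    then have "x - p = 0" by (intro assms(3)) (simp add: inner_commute)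
    then show ?thesis using p by simp
  qed
  then show ?thesis by auto
qed

text \<open>Both sides of the bound are continuous in \<open>y\<close>, so it extends to the whole
  space, where \<open>y = x\<close> may be taken.\<close>

lemma norm_le_if_inner_dense:
  fixes x :: "'a::real_inner"
  assumes "closure D = UNIV" "C \<ge> 0" "\<And>y. y \<in> D \<Longrightarrow> x \<bullet> y \<le> C * norm y"
  shows "norm x \<le> C"
proof -
  have "closed {y. x \<bullet> y \<le> C * norm y}"
    by (intro closed_Collect_le continuous_intros)
  then have "closure D \<subseteq> {y. x \<bullet> y \<le> C * norm y}"
    using assms(3) by (intro closure_minimal) auto
  then have "x \<bullet> x \<le> C * norm x" using assms(1) by auto
  then have "norm x * norm x \<le> C * norm x"
    by (simp add: power2_norm_eq_inner[symmetric] power2_eq_square)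
  then show ?thesis using assms(2) by (cases "x = 0") auto
qed

section \<open>Surjectivity of coercive operators, uniform boundedness, relative bounds\<close>

section \<open>Unbounded self-adjoint operators\<close>

lemma self_adjoint_operatorD:
  assumes "self_adjoint_operator D A"
  shows "subspace D" "closure D = UNIV"
    and "\<And>x y. x \<in> D \<Longrightarrow> y \<in> D \<Longrightarrow> A (x + y) = A x + A y"
    and "\<And>r x. x \<in> D \<Longrightarrow> A (r *\<^sub>R x) = r *\<^sub>R A x"
    and "\<And>x y. x \<in> D \<Longrightarrow> y \<in> D \<Longrightarrow> A x \<bullet> y = x \<bullet> A y"
    and "\<And>y z. (\<And>x. x \<in> D \<Longrightarrow> A x \<bullet> y = x \<bullet> z) \<Longrightarrow> y \<in> D \<and> A y = z"
proof -
  note * = assms[unfolded self_adjoint_operator_def linear_operator_def]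
  have graph: "(\<forall>x\<in>D. A x \<bullet> y = x \<bullet> z) \<longleftrightarrow> y \<in> D \<and> z = A y" for y z
    using * unfolding adjoint_graph_def by (auto simp: set_eq_iff)
  show "A x \<bullet> y = x \<bullet> A y" if "x \<in> D" "y \<in> D" for x y
    using graph[of y "A y"] that by blast
  show "y \<in> D \<and> A y = z" if "\<And>x. x \<in> D \<Longrightarrow> A x \<bullet> y = x \<bullet> z" for y z
    using graph[of y z] that by blast
qed (use assms in \<open>auto simp: self_adjoint_operator_def linear_operator_def\<close>)

lemma self_adjoint_operator_diff:
  assumes "self_adjoint_operator D A" "x \<in> D" "y \<in> D"
  shows "x - y \<in> D" "A (x - y) = A x - A y"
proof -
  note A = self_adjoint_operatorD[OF assms(1)]
  show "x - y \<in> D" using A(1) assms by (simp add: subspace_diff)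
  have "A (x + (- 1) *\<^sub>R y) = A x + A ((- 1) *\<^sub>R y)"
    using A(1) assms by (intro A(3)) (auto simp: subspace_neg)
  also have "A ((- 1) *\<^sub>R y) = (- 1) *\<^sub>R A y" by (rule A(4)[OF assms(3)])
  finally show "A (x - y) = A x - A y" by simp
qed

text \<open>The identity summand can be moved to the right-hand side of the adjoint relation, so
  \<open>y\<close> is in the adjoint domain of \<open>A\<close> with value
  \<open>(z - y) / c\<close>.\<close>

lemma self_adjoint_operator_shift:
  assumes A: "self_adjoint_operator D A" and c: "c > 0"
  shows "self_adjoint_operator D (\<lambda>x. x + c *\<^sub>R A x)"
proof -
  note A' = self_adjoint_operatorD[OF A]
  have "y \<in> D \<and> z = y + c *\<^sub>R A y" if *: "\<forall>x\<in>D. (x + c *\<^sub>R A x) \<bullet> y = x \<bullet> z" for y z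
  proof -
    have "y \<in> D \<and> A y = (1 / c) *\<^sub>R (z - y)"
    proof (rule A'(6))
      fix x assume "x \<in> D"
      then have "x \<bullet> y + c * (A x \<bullet> y) = x \<bullet> z" using * by (simp add: inner_simps)
      then show "A x \<bullet> y = x \<bullet> ((1 / c) *\<^sub>R (z - y))" using c by (simp add: inner_simps field_simps)
    qed
    then show ?thesis using c by simp
  qed
  moreover have "(x + c *\<^sub>R A x) \<bullet> y = x \<bullet> (y + c *\<^sub>R A y)" if "x \<in> D" "y \<in> D" for x y
    using A'(5)[OF that] by (simp add: inner_simps)
  ultimately have "adjoint_graph D (\<lambda>x. x + c *\<^sub>R A x) = {(x, x + c *\<^sub>R A x) |x. x \<in> D}"
    unfolding adjoint_graph_def by blast
  moreover have "linear_operator D (\<lambda>x. x + c *\<^sub>R A x)"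
    unfolding linear_operator_def using A'(1,3,4) by (simp add: scaleR_add_right mult.commute)
  ultimately show ?thesis
    using A'(2) by (simp add: self_adjoint_operator_def)
qed

text \<open>The lower bound makes the range closed; a vector orthogonal to the range lies in the
  kernel of the adjoint, which is \<open>A\<close> itself, and so vanishes.\<close>

lemma self_adjoint_operator_surj:
  fixes D :: "'a::{real_inner, complete_space} set"
  assumes A: "self_adjoint_operator D A" and c: "c > 0" and b: "bounded_below_by c D A"
  shows "A ` D = UNIV"
proof (rule subspace_eq_UNIV_if_orthogonal_trivial)
  note A' = self_adjoint_operatorD[OF A]
  have lower: "c * norm x \<le> norm (A x)" if "x \<in> D" for x
  proof (cases "x = 0")
    case False
    have "c * (norm x)\<^sup>2 \<le> A x \<bullet> x" using b that by (simp add: bounded_below_by_def)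
    also have "\<dots> \<le> norm (A x) * norm x" by (rule norm_cauchy_schwarz)
    finally show ?thesis using False by (simp add: power2_eq_square)
  qed simp
  show "subspace (A ` D)"
    unfolding subspace_def
  proof (intro conjI ballI allI)
    show "0 \<in> A ` D" using A'(4)[of 0 0] subspace_0[OF A'(1)] by (intro image_eqI[of _ _ 0]) auto
  next
    fix x y assume "x \<in> A ` D" "y \<in> A ` D"
    then obtain x' y' where "x' \<in> D" "y' \<in> D" "x = A x'" "y = A y'" by auto
    then show "x + y \<in> A ` D" using A'(3) subspace_add[OF A'(1)]
      by (intro image_eqI[of _ _ "x' + y'"]) auto
  next
    fix r x assume "x \<in> A ` D"
    then obtain x' where "x' \<in> D" "x = A x'" by auto
    then show "r *\<^sub>R x \<in> A ` D" using A'(4) subspace_scale[OF A'(1)]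
      by (intro image_eqI[of _ _ "r *\<^sub>R x'"]) auto
  qed
  show "closed (A ` D)"
    unfolding closed_sequential_limits
  proof (intro allI impI, elim conjE)
    fix s y assume "\<forall>n. s n \<in> A ` D" and sy: "s \<longlonglongrightarrow> y"
    then obtain x where x: "\<And>n. x n \<in> D" "\<And>n. s n = A (x n)"
      unfolding image_iff by metis
    have d: "dist (x m) (x n) \<le> dist (s m) (s n) / c" for m n
      using lower[of "x m - x n"] self_adjoint_operator_diff[OF A x(1) x(1), of m n] c
      by (simp add: dist_norm x(2) field_simps)
    have "Cauchy x"
    proof (rule metric_CauchyI)
      fix e :: real assume "e > 0"
      then obtain N where N: "\<forall>m\<ge>N. \<forall>n\<ge>N. dist (s m) (s n) < e * c"
        using metric_CauchyD[OF LIMSEQ_imp_Cauchy[OF sy], of "e * c"] c by auto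
      have "dist (x m) (x n) < e" if "m \<ge> N" "n \<ge> N" for m n
      proof -
        have "dist (s m) (s n) / c < e" using N that c by (simp add: field_simps)
        then show ?thesis using d[of m n] by simp
      qed
      then show "\<exists>M. \<forall>m\<ge>M. \<forall>n\<ge>M. dist (x m) (x n) < e" by blast
    qed
    then obtain p where p: "x \<longlonglongrightarrow> p" using Cauchy_convergent convergent_def by blast
    \<comment> \<open>Closedness of \<open>A\<close>: the limit of the symmetry relation places
      \<open>p\<close> in the domain of the adjoint.\<close>
    have "p \<in> D \<and> A p = y"
    proof (rule A'(6))
      fix z assume z: "z \<in> D"
      have "(\<lambda>n. A z \<bullet> x n) \<longlonglongrightarrow> A z \<bullet> p" by (intro tendsto_intros p)
      moreover have "(\<lambda>n. z \<bullet> s n) \<longlonglongrightarrow> z \<bullet> y" by (intro tendsto_intros sy)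
      moreover have "A z \<bullet> x n = z \<bullet> s n" for n using A'(5)[OF z x(1)] x(2) by simp
      ultimately show "A z \<bullet> p = z \<bullet> y" using LIMSEQ_unique by fastforce
    qed
    then show "y \<in> A ` D" by auto
  qed
  show "y = 0" if "\<And>s. s \<in> A ` D \<Longrightarrow> s \<bullet> y = 0" for y
  proof -
    have "y \<in> D \<and> A y = 0" using that by (intro A'(6)) auto
    then show ?thesis using lower[of y] c by (simp add: mult_le_0_iff)
  qed
qed

text \<open>This brings everywhere defined operators under
  \<open>self_adjoint_operator_surj\<close>, by which \<open>P\<close> is inverted later.\<close>

lemma self_adjoint_operator_UNIV:
  assumes "linear P" "\<And>x y. P x \<bullet> y = x \<bullet> P y"
  shows "self_adjoint_operator UNIV P"
proof -
  have "z = P y" if "\<And>x. P x \<bullet> y = x \<bullet> z" for y z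
  proof -
    have "(z - P y) \<bullet> (z - P y) = 0"
      using that[of "z - P y"] assms(2)[of "z - P y" y] by (simp add: inner_diff_right)
    then show ?thesis by simp
  qed
  then show ?thesis
    using assms unfolding self_adjoint_operator_def linear_operator_def adjoint_graph_def
    by (auto simp: linear_add linear_scale)
qed

text \<open>Baire category: the closed sets where all functionals are bounded by \<open>n\<close>
  cover the space, so one of them contains a ball.\<close>

lemma uniform_boundedness_inner:
  fixes S :: "'a::{real_inner, complete_space} set"
  assumes pw: "\<And>x. \<exists>C. \<forall>p\<in>S. \<bar>x \<bullet> p\<bar> \<le> C"
  shows "\<exists>C\<ge>0. \<forall>p\<in>S. \<forall>x. \<bar>x \<bullet> p\<bar> \<le> C * norm x"
proof -
  define F where "F n = {x. \<forall>p\<in>S. \<bar>x \<bullet> p\<bar> \<le> real n}" for n :: nat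
  have cl: "closed (F n)" for n
  proof -
    have "F n = (\<Inter>p\<in>S. {x. \<bar>x \<bullet> p\<bar> \<le> real n})" by (auto simp: F_def)
    then show ?thesis by (auto intro!: closed_INT closed_Collect_le continuous_intros)
  qed
  have un: "(\<Union>n. F n) = UNIV"
  proof -
    have "\<exists>n. x \<in> F n" for x
    proof -
      obtain C where C: "\<forall>p\<in>S. \<bar>x \<bullet> p\<bar> \<le> C" using pw by blast
      obtain n :: nat where "C \<le> real n" using real_arch_simple by blast
      then have "x \<in> F n" using C unfolding F_def by (blast intro: order_trans)
      then show ?thesis ..
    qed
    then show ?thesis by auto
  qed
  have "\<exists>n. interior (F n) \<noteq> {}"
  proof (rule ccontr)
    assume *: "\<not> ?thesis"
    have "euclidean interior_of \<Union>(range F) = {}"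
    proof (rule Baire_category_alt)
      have "Met_TC.mcomplete TYPE('a)"
        by (simp add: complete_UNIV)
      then show "completely_metrizable_space (euclidean::'a topology) \<or>
          locally_compact_space (euclidean::'a topology) \<and> regular_space (euclidean::'a topology)"
        using Met_TC.completely_metrizable_space_mtopology by auto
    qed (use cl * in \<open>auto simp: euclidean_interior_of\<close>)
    then show False using un by simp
  qed
  then obtain n z where "z \<in> interior (F n)" by blast
  then obtain e where e: "e > 0" "cball z e \<subseteq> F n"
    by (meson interior_subset open_contains_cball open_interior order_trans)
  have "\<bar>x \<bullet> p\<bar> \<le> (2 * real n / e) * norm x" if p: "p \<in> S" for p x
  proof (cases "x = 0")
    case False
    \<comment> \<open>\<open>y\<close> is \<open>x\<close> rescaled to length \<open>e\<close>; the
      bounds at \<open>z + y\<close> and at the centre \<open>z\<close> combine to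
      \<open>2 * n\<close> at \<open>y\<close>.\<close>
    define y where "y = (e / norm x) *\<^sub>R x"
    have "z + y \<in> F n" "z \<in> F n" using e False by (auto simp: y_def dist_norm intro!: subsetD[OF e(2)])
    then have "\<bar>(z + y) \<bullet> p\<bar> \<le> n" "\<bar>z \<bullet> p\<bar> \<le> n" using p by (auto simp: F_def)
    then have "\<bar>y \<bullet> p\<bar> \<le> 2 * n" by (simp add: inner_add_left)
    then show ?thesis using False e by (simp add: y_def field_simps abs_mult)
  qed simp
  then show ?thesis using e by (intro exI[of _ "2 * real n / e"]) auto
qed

text \<open>For \<open>y\<close> in the domain of \<open>A'\<close>, the functional \<open>w \<mapsto> A' (A\<^sup>-\<^sup>1 w) \<bullet> y\<close> is represented by
  \<open>A\<^sup>-\<^sup>1 (A' y)\<close>, so uniform boundedness replaces the closed graph theorem.\<close>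
lemma self_adjoint_operator_relatively_bounded:
  fixes D :: "'a::{real_inner, complete_space} set"
  assumes A: "self_adjoint_operator D A" "c > 0" "bounded_below_by c D A"
    and A': "self_adjoint_operator D' A'" and sub: "D \<subseteq> D'"
  shows "\<exists>C\<ge>0. \<forall>x\<in>D. norm (A' x) \<le> C * norm (A x)"
proof -
  note a = self_adjoint_operatorD[OF A(1)] and a' = self_adjoint_operatorD[OF A']
  have surj: "A ` D = UNIV" by (rule self_adjoint_operator_surj[OF A])
  then have "\<exists>q\<in>D. A q = A' y" for y by (metis UNIV_I imageE)
  then obtain p where p: "\<And>y. p y \<in> D" "\<And>y. A (p y) = A' y" by metis
  have eq: "A x \<bullet> p y = A' x \<bullet> y" if "x \<in> D" "y \<in> D'" for x y
    using a(5)[OF that(1) p(1)] a'(5)[of x y] that sub p(2) by auto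
  \<comment> \<open>The representing vectors of the unit ball of \<open>D'\<close>; tested with
    \<open>w = A x\<close> they are bounded by \<open>norm (A' x)\<close>.\<close>
  define S where "S = p ` {y\<in>D'. norm y \<le> 1}"
  have "\<exists>C. \<forall>q\<in>S. \<bar>w \<bullet> q\<bar> \<le> C" for w
  proof -
    obtain x where x: "x \<in> D" "w = A x" using surj by (metis UNIV_I imageE)
    have "\<bar>w \<bullet> q\<bar> \<le> norm (A' x)" if "q \<in> S" for q
    proof -
      obtain y where y: "y \<in> D'" "norm y \<le> 1" "q = p y" using \<open>q \<in> S\<close> S_def by auto
      have "\<bar>A' x \<bullet> y\<bar> \<le> norm (A' x) * norm y" by (rule Cauchy_Schwarz_ineq2)
      also have "\<dots> \<le> norm (A' x)" using y by (simp add: mult_left_le)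
      finally show ?thesis using eq[OF x(1) y(1)] x y by simp
    qed
    then show ?thesis by blast
  qed
  then obtain C where C: "C \<ge> 0" "\<And>q x. q \<in> S \<Longrightarrow> \<bar>x \<bullet> q\<bar> \<le> C * norm x"
    using uniform_boundedness_inner[of S] by blast
  have "norm (A' x) \<le> C * norm (A x)" if x: "x \<in> D" for x
  proof (rule norm_le_if_inner_dense[OF a'(2)])
    fix y assume y: "y \<in> D'"
    show "A' x \<bullet> y \<le> C * norm (A x) * norm y"
    proof (cases "y = 0")
      case False
      define z where "z = (1 / norm y) *\<^sub>R y"
      have z: "z \<in> D'" "norm z \<le> 1" using y a'(1) False by (auto simp: z_def subspace_scale)
      then have "A x \<bullet> p z \<le> C * norm (A x)" using C(2)[of "p z" "A x"] by (auto simp: S_def)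
      then have "A' x \<bullet> z \<le> C * norm (A x)" using eq[OF x z(1)] by simp
      then show ?thesis using False by (simp add: z_def field_simps)
    qed simp
  qed (use C in simp)
  then show ?thesis using C(1) by blast
qed

section \<open>Form bounds for \<open>I - R\<close> without spectral calculus\<close>

section \<open>Resolvents of nonnegative self-adjoint operators\<close>

lemma nonneg_resolvent_exists:
  fixes D :: "'a::{real_inner, complete_space} set"
  assumes A: "self_adjoint_operator D A" "bounded_below_by 0 D A" and c: "c > 0"
  shows "\<exists>x\<in>D. x + c *\<^sub>R A x = y"
proof -
  have "bounded_below_by 1 D (\<lambda>x. x + c *\<^sub>R A x)"
    using A(2) c by (simp add: bounded_below_by_def inner_simps power2_norm_eq_inner)
  from self_adjoint_operator_surj[OF self_adjoint_operator_shift[OF A(1) c] zero_less_one this]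
  have "y \<in> (\<lambda>x. x + c *\<^sub>R A x) ` D" by simp
  then show ?thesis by blast
qed

text \<open>\<open>R\<close> is the inverse of \<open>I + c A\<close>, introduced only as a right
  inverse, which is what a choice of solutions supplies.\<close>

locale nonneg_resolvent =
  fixes D :: "'a::real_inner set" and A :: "'a \<Rightarrow> 'a" and c :: real and R :: "'a \<Rightarrow> 'a"
  assumes self_adjoint: "self_adjoint_operator D A"
    and nonneg: "bounded_below_by 0 D A"
    and c_pos: "c > 0"
    and mem [simp]: "R y \<in> D"
    and inverse: "R y + c *\<^sub>R A (R y) = y"
begin

lemmas domain = self_adjoint_operatorD[OF self_adjoint]

lemma A_nonneg: "x \<in> D \<Longrightarrow> 0 \<le> A x \<bullet> x"
  using nonneg by (simp add: bounded_below_by_def)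

text \<open>\<open>I + c A\<close> is injective, since its form dominates the squared norm.\<close>

lemma left_inverse:
  assumes x: "x \<in> D"
  shows "R (x + c *\<^sub>R A x) = x"
proof -
  define z where "z = x + c *\<^sub>R A x"
  note d = self_adjoint_operator_diff[OF self_adjoint mem x, of z]
  have "(R z - x) + c *\<^sub>R A (R z - x) = 0"
    using inverse[of z] unfolding d(2) by (simp add: z_def algebra_simps)
  then have "((R z - x) + c *\<^sub>R A (R z - x)) \<bullet> (R z - x) = 0" by simp
  then have "(R z - x) \<bullet> (R z - x) + c * (A (R z - x) \<bullet> (R z - x)) = 0"
    by (simp add: inner_add_left)
  moreover have "c * (A (R z - x) \<bullet> (R z - x)) \<ge> 0" using A_nonneg[OF d(1)] c_pos by simp
  ultimately have "(R z - x) \<bullet> (R z - x) \<le> 0" by linarith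
  then have "R z - x = 0" by (metis inner_gt_zero_iff not_le)
  then show ?thesis by (simp add: z_def)
qed

lemma linear_R: "linear R"
proof
  fix x y r
  \<comment> \<open>Linearity is uniqueness: both candidates solve the same equation.\<close>
  have "R ((R x + R y) + c *\<^sub>R A (R x + R y)) = R x + R y"
    by (intro left_inverse subspace_add domain(1) mem)
  moreover have "(R x + R y) + c *\<^sub>R A (R x + R y) = x + y"
  proof -
    have "(R x + R y) + c *\<^sub>R A (R x + R y) = (R x + c *\<^sub>R A (R x)) + (R y + c *\<^sub>R A (R y))"
      by (simp add: domain(3) scaleR_add_right)
    then show ?thesis by (simp add: inverse)
  qed
  ultimately show "R (x + y) = R x + R y" by simp
  have "R ((r *\<^sub>R R x) + c *\<^sub>R A (r *\<^sub>R R x)) = r *\<^sub>R R x"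
    by (intro left_inverse subspace_scale domain(1) mem)
  moreover have "(r *\<^sub>R R x) + c *\<^sub>R A (r *\<^sub>R R x) = r *\<^sub>R (R x + c *\<^sub>R A (R x))"
    by (simp add: domain(4) scaleR_add_right mult.commute)
  ultimately show "R (r *\<^sub>R x) = r *\<^sub>R R x" by (simp add: inverse)
qed

lemma compl_eq: "y - R y = c *\<^sub>R A (R y)"
  by (subst (1) inverse[of y, symmetric]) simp

lemma R_symmetric: "R x \<bullet> y = x \<bullet> R y"
proof -
  have "R x \<bullet> (R y + c *\<^sub>R A (R y)) = (R x + c *\<^sub>R A (R x)) \<bullet> R y"
    using domain(5)[OF mem mem, of x y] by (simp add: inner_simps)
  then show ?thesis by (simp add: inverse)
qed

text \<open>Split the second factor as \<open>R y + (y - R y)\<close> and use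
  \<open>I - R = c A R\<close>. Both resulting terms are nonnegative, and each later controls its
  own part of \<open>y\<close>.\<close>

lemma compl_inner: "(y - R y) \<bullet> y = c * (A (R y) \<bullet> R y) + (norm (y - R y))\<^sup>2"
proof -
  have "(y - R y) \<bullet> y = (y - R y) \<bullet> R y + (y - R y) \<bullet> (y - R y)"
    by (simp add: inner_diff_right)
  also have "(y - R y) \<bullet> R y = c * (A (R y) \<bullet> R y)" by (simp add: compl_eq)
  finally show ?thesis by (simp add: power2_norm_eq_inner)
qed

lemma compl_norm_le: "(norm (y - R y))\<^sup>2 \<le> (y - R y) \<bullet> y"
  unfolding compl_inner using A_nonneg[OF mem] c_pos by simp

lemma R_nonneg: "0 \<le> R y \<bullet> y"
proof -
  have "R y \<bullet> y = R y \<bullet> R y + c * (A (R y) \<bullet> R y)"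
    by (subst (2) inverse[of y, symmetric]) (simp add: inner_add_right inner_commute)
  then show ?thesis using A_nonneg[OF mem] c_pos by simp
qed

lemma norm_R_le: "norm (R y) \<le> norm y"
proof -
  have "(norm (R y))\<^sup>2 = (norm (y - R y))\<^sup>2 - 2 * ((y - R y) \<bullet> y) + (norm y)\<^sup>2"
    by (simp add: power2_norm_eq_inner inner_simps inner_commute)
  also have "\<dots> \<le> (norm y)\<^sup>2"
    using compl_norm_le[of y] zero_le_power2[of "norm (y - R y)"] by linarith
  finally show ?thesis by (rule power2_le_imp_le) simp
qed

lemma compl_domain:
  assumes "x \<in> D"
  shows "x - R x = c *\<^sub>R R (A x)"
proof -
  have "R x + c *\<^sub>R R (A x) = x"
    using left_inverse[OF assms] by (simp add: linear_add[OF linear_R] linear_scale[OF linear_R])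
  then show ?thesis by (metis add_diff_cancel_left')
qed

text \<open>Operator version of \<open>s / (1 + s) \<le> s\<close> with \<open>s = c A\<close>; the
  two sides differ by \<open>c * c * (R (A x) \<bullet> A x)\<close>.\<close>

lemma compl_inner_le:
  assumes "x \<in> D"
  shows "(x - R x) \<bullet> x \<le> c * (A x \<bullet> x)"
proof -
  have "(x - R x) \<bullet> x = c * (A x \<bullet> R x)"
    unfolding compl_domain[OF assms] inner_scaleR_left R_symmetric ..
  also have "A x \<bullet> R x = A x \<bullet> x - A x \<bullet> (x - R x)" by (simp add: inner_diff_right)
  also have "A x \<bullet> (x - R x) = c * (R (A x) \<bullet> A x)"
    unfolding compl_domain[OF assms] inner_scaleR_right by (simp add: inner_commute)
  finally show ?thesis using R_nonneg[of "A x"] c_pos by simp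
qed

text \<open>Operator version of \<open>s / (1 + s) \<ge> min s 1 / 2\<close>: in
  \<open>y = R y + (y - R y)\<close> the summands are bounded by the two terms of
  \<open>compl_inner\<close>, the first through \<open>\<alpha>\<close>.\<close>

lemma compl_coercive:
  assumes "bounded_below_by \<alpha> D A" and m: "0 \<le> m" "m \<le> c * \<alpha>" "m \<le> 1"
  shows "m / 2 * (norm y)\<^sup>2 \<le> (y - R y) \<bullet> y"
proof -
  have "norm y \<le> norm (R y) + norm (y - R y)"
    using norm_triangle_ineq[of "R y" "y - R y"] by simp
  then have "(norm y)\<^sup>2 \<le> (norm (R y) + norm (y - R y))\<^sup>2" by (simp add: power_mono)
  also have "\<dots> \<le> 2 * (norm (R y))\<^sup>2 + 2 * (norm (y - R y))\<^sup>2"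
    using sum_squares_bound[of "norm (R y)" "norm (y - R y)"] by (simp add: power2_sum)
  finally have "m / 2 * (norm y)\<^sup>2 \<le> m / 2 * (2 * (norm (R y))\<^sup>2 + 2 * (norm (y - R y))\<^sup>2)"
    using m by (intro mult_left_mono) auto
  also have "\<dots> = m * (norm (R y))\<^sup>2 + m * (norm (y - R y))\<^sup>2" by (simp add: distrib_left)
  also have "\<dots> \<le> (c * \<alpha>) * (norm (R y))\<^sup>2 + 1 * (norm (y - R y))\<^sup>2"
    using m by (intro add_mono mult_right_mono) auto
  also have "(c * \<alpha>) * (norm (R y))\<^sup>2 = c * (\<alpha> * (norm (R y))\<^sup>2)" by simp
  also have "\<dots> \<le> c * (A (R y) \<bullet> R y)"
    using assms c_pos by (intro mult_left_mono) (auto simp: bounded_below_by_def)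
  finally show ?thesis unfolding compl_inner by simp
qed

end

section \<open>Stability of one step in the dual energy; remainder formulas\<close>

section \<open>Discrete energy estimates and Taylor's formula\<close>

text \<open>The discriminant argument for the quadratic in \<open>t\<close> given by the form at
  \<open>x - t *\<^sub>R y\<close>, with a separate case for a degenerate form.\<close>

lemma psd_Cauchy_Schwarz:
  fixes P :: "'a::real_inner \<Rightarrow> 'a"
  assumes P: "linear P" "\<And>x y. P x \<bullet> y = x \<bullet> P y" and psd: "\<And>x. 0 \<le> P x \<bullet> x"
  shows "P x \<bullet> y \<le> sqrt (P x \<bullet> x) * sqrt (P y \<bullet> y)"
proof -
  have quad: "0 \<le> P x \<bullet> x - 2 * t * (P x \<bullet> y) + t\<^sup>2 * (P y \<bullet> y)" for t
  proof -
    have "P y \<bullet> x = P x \<bullet> y" using P(2)[of y x] by (simp add: inner_commute)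
    then have "P (x - t *\<^sub>R y) \<bullet> (x - t *\<^sub>R y) = P x \<bullet> x - 2 * t * (P x \<bullet> y) + t\<^sup>2 * (P y \<bullet> y)"
      by (simp add: linear_diff[OF P(1)] linear_scale[OF P(1)] inner_diff_left inner_diff_right
          power2_eq_square algebra_simps)
    then show ?thesis using psd[of "x - t *\<^sub>R y"] by simp
  qed
  have "(P x \<bullet> y)\<^sup>2 \<le> (P x \<bullet> x) * (P y \<bullet> y)"
  proof (cases "P y \<bullet> y = 0")
    case True
    have "P x \<bullet> y = 0"
    proof (rule ccontr)
      assume "P x \<bullet> y \<noteq> 0"
      then show False
        \<comment> \<open>With vanishing leading coefficient the polynomial is affine, and this
          \<open>t\<close> gives it the value -1.\<close>
        using quad[of "(P x \<bullet> x + 1) / (2 * (P x \<bullet> y))"] True by simp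
    qed
    then show ?thesis using True by simp
  next
    case False
    then have pos: "P y \<bullet> y > 0" using psd[of y] by simp
    have "0 \<le> (P y \<bullet> y) * (P x \<bullet> x - 2 * ((P x \<bullet> y) / (P y \<bullet> y)) * (P x \<bullet> y)
        + ((P x \<bullet> y) / (P y \<bullet> y))\<^sup>2 * (P y \<bullet> y))"
      by (rule mult_nonneg_nonneg[OF less_imp_le[OF pos] quad])
    also have "\<dots> = (P x \<bullet> x) * (P y \<bullet> y) - (P x \<bullet> y)\<^sup>2"
      using pos by (simp add: field_simps power2_eq_square)
    finally show ?thesis by simp
  qed
  then have "sqrt ((P x \<bullet> y)\<^sup>2) \<le> sqrt ((P x \<bullet> x) * (P y \<bullet> y))"
    by (rule real_sqrt_le_mono)
  then show ?thesis by (simp add: real_sqrt_mult)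
qed

text \<open>Otherwise \<open>(sqrt F - 2 * \<gamma>) * sqrt F\<close> would exceed \<open>e\<close>.
  This removes the unknown energy from the right side of the energy inequality.\<close>

lemma sqrt_le_of_le_add_sqrt:
  fixes e F \<gamma> :: real
  assumes "0 \<le> e" "0 \<le> F" "0 \<le> \<gamma>" "F \<le> e + 2 * \<gamma> * sqrt F"
  shows "sqrt F \<le> sqrt e + 2 * \<gamma>"
proof (rule ccontr)
  assume *: "\<not> ?thesis"
  have "sqrt e < sqrt F - 2 * \<gamma>" "sqrt e < sqrt F" using * assms(3) by linarith+
  then have "sqrt e * sqrt e < (sqrt F - 2 * \<gamma>) * sqrt F"
    using assms(1) by (intro mult_strict_mono') auto
  then show False using assms by (simp add: left_diff_distrib)
qed

text \<open>For injective \<open>P\<close> and \<open>d = P q\<close> this is \<open>\<parallel>d\<parallel>\<^sup>2\<close> in the seminorm of \<open>P\<^sup>-\<^sup>1 - I\<close>, plus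
  \<open>\<parallel>w\<parallel>\<^sup>2\<close>.\<close>
definition dual_energy :: "('a::real_inner \<Rightarrow> 'a) \<Rightarrow> 'a \<Rightarrow> 'a \<Rightarrow> real" where
  "dual_energy P q w = P q \<bullet> q - (norm (P q))\<^sup>2 + (norm w)\<^sup>2"

text \<open>The form \<open>b\<close> is semidefinite because the square of \<open>P\<close> is at
  most \<open>P\<close>. Tested with \<open>q2\<close>, the recursion becomes two expressions of the
  type \<open>(x - y, x)\<close>, and twice such an expression is a difference of squares plus a
  nonnegative remainder.\<close>

lemma dual_energy_step:
  fixes P :: "'a::real_inner \<Rightarrow> 'a"
  assumes P: "linear P" "\<And>x y. P x \<bullet> y = x \<bullet> P y" "\<And>x. (norm (P x))\<^sup>2 \<le> P x \<bullet> x"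
    and d: "w1 - w0 = P q1" "w2 - w1 = P q2"
    and eq: "(w2 - 2 *\<^sub>R w1 + w0) + P (2 *\<^sub>R w1 - w0) = g"
    and \<gamma>: "0 \<le> \<gamma>" "g \<bullet> q2 \<le> \<gamma> * sqrt (P q2 \<bullet> q2)"
  shows "sqrt (dual_energy P q2 w2) \<le> sqrt (dual_energy P q1 w1) + 2 * \<gamma>"
proof -
  define b where "b x y = P x \<bullet> y - P x \<bullet> P y" for x y
  have b_nonneg: "0 \<le> b x x" for x
    using P(3)[of x] by (simp add: b_def power2_norm_eq_inner)
  have b_sym: "b x y = b y x" for x y
    using P(2)[of x y] by (simp add: b_def inner_commute)
  have b_diff: "b (x - y) z = b x z - b y z" for x y z
    by (simp add: b_def linear_diff[OF P(1)] inner_diff_left)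
  have b_diff2: "b z (x - y) = b z x - b z y" for x y z
    using b_sym[of z] b_diff by simp
  have E: "dual_energy P q w = b q q + (norm w)\<^sup>2" for q w
    by (simp add: dual_energy_def b_def power2_norm_eq_inner)
  have w: "2 *\<^sub>R w1 - w0 = w2 - (P q2 - P q1)" "w2 - 2 *\<^sub>R w1 + w0 = P q2 - P q1"
    by (simp_all add: d[symmetric] scaleR_2)
  have "g \<bullet> q2 = (P q2 - P q1) \<bullet> q2 + (2 *\<^sub>R w1 - w0) \<bullet> P q2"
    by (simp add: eq[symmetric] w(2) inner_add_left P(2))
  also have "\<dots> = b (q2 - q1) q2 + w2 \<bullet> (w2 - w1)"
    unfolding w(1) b_def d(2) by (simp add: linear_diff[OF P(1)] inner_diff_left)
  finally have g: "g \<bullet> q2 = b (q2 - q1) q2 + w2 \<bullet> (w2 - w1)" .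
  have "2 * b (q2 - q1) q2 = b q2 q2 - b q1 q1 + b (q2 - q1) (q2 - q1)"
    using b_sym[of q1 q2] by (simp add: b_diff b_diff2)
  moreover have "2 * (w2 \<bullet> (w2 - w1)) = (norm w2)\<^sup>2 - (norm w1)\<^sup>2 + (norm (w2 - w1))\<^sup>2"
    by (simp add: power2_norm_eq_inner inner_diff_left inner_diff_right inner_commute)
  ultimately have *: "2 * (g \<bullet> q2) \<ge> dual_energy P q2 w2 + (norm (P q2))\<^sup>2 - dual_energy P q1 w1"
    using b_nonneg[of "q2 - q1"] unfolding g E d(2) by simp
  \<comment> \<open>The remainder \<open>(norm (w2 - w1))\<^sup>2\<close> is kept because
    \<open>dual_energy\<close> subtracts exactly this: \<open>F\<close> then dominates
    \<open>P q2 \<bullet> q2\<close>, which controls the pairing with \<open>g\<close>.\<close>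
  define F where "F = dual_energy P q2 w2 + (norm (P q2))\<^sup>2"
  have "P q2 \<bullet> q2 \<le> F" by (simp add: F_def dual_energy_def)
  then have "\<gamma> * sqrt (P q2 \<bullet> q2) \<le> \<gamma> * sqrt F"
    using \<gamma> by (intro mult_left_mono) auto
  then have "F \<le> dual_energy P q1 w1 + 2 * \<gamma> * sqrt F" using * \<gamma>(2) by (simp add: F_def)
  then have "sqrt F \<le> sqrt (dual_energy P q1 w1) + 2 * \<gamma>"
    using \<gamma> b_nonneg by (intro sqrt_le_of_le_add_sqrt) (auto simp: F_def E)
  moreover have "sqrt (dual_energy P q2 w2) \<le> sqrt F" by (simp add: F_def)
  ultimately show ?thesis by linarith
qed

lemma norm_le_sqrt_dual_energy:
  assumes "(norm (P q))\<^sup>2 \<le> P q \<bullet> q"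
  shows "norm w \<le> sqrt (dual_energy P q w)"
  using assms by (intro real_le_rsqrt) (simp add: dual_energy_def)

text \<open>\<open>e k + h\<close> satisfies a homogeneous recursion with factor
  \<open>1 + c\<close>. Indices start at 1 because the energy involves two consecutive time
  levels.\<close>

lemma discrete_Gronwall:
  fixes e :: "nat \<Rightarrow> real"
  assumes "0 \<le> c" "0 \<le> h" "0 \<le> e 1"
    and step: "\<And>k. 1 \<le> k \<Longrightarrow> k < n \<Longrightarrow> e (Suc k) \<le> (1 + c) * e k + c * h"
    and k: "1 \<le> k" "k \<le> n"
  shows "e k \<le> exp (c * n) * (e 1 + h)"
proof -
  have "e k + h \<le> (1 + c) ^ (k - 1) * (e 1 + h)"
    using k
  proof (induction k rule: nat_induct_at_least)
    case (Suc k)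
    have "e (Suc k) + h \<le> (1 + c) * (e k + h)"
      using step[of k] Suc by (simp add: algebra_simps)
    also have "\<dots> \<le> (1 + c) * ((1 + c) ^ (k - 1) * (e 1 + h))"
      using Suc assms(1) by (intro mult_left_mono) auto
    also have "\<dots> = (1 + c) ^ (Suc k - 1) * (e 1 + h)"
      using Suc by (cases k) auto
    finally show ?case .
  qed simp
  also have "\<dots> \<le> exp (c * n) * (e 1 + h)"
  proof (rule mult_right_mono)
    have "(1 + c) ^ (k - 1) \<le> exp c ^ (k - 1)" using assms(1) by (intro power_mono) auto
    also have "\<dots> \<le> exp c ^ n" using assms(1) k by (intro power_increasing) auto
    also have "\<dots> = exp (c * n)" by (simp add: exp_of_nat2_mult)
    finally show "(1 + c) ^ (k - 1) \<le> exp (c * n)" .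
  qed (use assms in simp)
  finally show ?thesis using assms(2) by simp
qed

text \<open>Taylor's formula with one-sided derivatives at the end points, which is why the theorem
  \<open>Taylor\<close> of the library does not apply. Rolle's theorem is applied to
  \<open>(t - s)\<^sup>2 \<psi>(x) - (t - x)\<^sup>2 \<psi>(s)\<close>, where \<open>\<psi>(x) = \<phi>(t) - \<phi>(x) - \<phi>'(x) (t - x)\<close>.\<close>
lemma Taylor2_within:
  fixes \<phi> \<phi>' \<phi>'' :: "real \<Rightarrow> real"
  assumes d: "\<And>x. x \<in> {p..q} \<Longrightarrow> (\<phi> has_real_derivative \<phi>' x) (at x within {p..q})"
    and d': "\<And>x. x \<in> {p..q} \<Longrightarrow> (\<phi>' has_real_derivative \<phi>'' x) (at x within {p..q})"
    and st: "s \<in> {p..q}" "t \<in> {p..q}" "s \<noteq> t"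
  shows "\<exists>\<xi>\<in>{min s t..max s t}. \<phi> t = \<phi> s + \<phi>' s * (t - s) + \<phi>'' \<xi> * (t - s)\<^sup>2 / 2"
proof -
  define \<psi> where "\<psi> x = \<phi> t - \<phi> x - \<phi>' x * (t - x)" for x
  define G where "G x = \<psi> x * (t - s)\<^sup>2 - \<psi> s * (t - x)\<^sup>2" for x
  define G' where "G' x = - \<phi>'' x * (t - x) * (t - s)\<^sup>2 + 2 * \<psi> s * (t - x)" for x
  define l r where "l = min s t" and "r = max s t"
  have lr: "l < r" "{l..r} \<subseteq> {p..q}" using st by (auto simp: l_def r_def)
  have G: "(G has_real_derivative G' x) (at x within {p..q})" if "x \<in> {p..q}" for x
    unfolding G_def \<psi>_def G'_def
    by (auto intro!: derivative_eq_intros d[OF that] d'[OF that] simp: algebra_simps)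
  have G_at: "(G has_real_derivative G' x) (at x)" if "l < x" "x < r" for x
  proof -
    have "x \<in> interior {p..q}" using that lr(2) lr(1)
      by (intro subsetD[OF interior_mono[OF lr(2)]]) (simp add: interior_atLeastAtMost_real)
    then show ?thesis using G[of x] at_within_interior[of x "{p..q}"] interior_subset by fastforce
  qed
  have "continuous_on {l..r} G"
    using lr(2) by (intro continuous_on_subset[OF DERIV_continuous_on[OF G]]) auto
  \<comment> \<open>\<open>G\<close> vanishes at both \<open>s\<close> and \<open>t\<close>.\<close>
  moreover have "G l = G r" by (auto simp: G_def \<psi>_def l_def r_def min_def max_def)
  moreover have "G differentiable (at x)" if "l < x" "x < r" for x
    using G_at[OF that] real_differentiable_def by blast
  ultimately obtain \<xi> where \<xi>: "l < \<xi>" "\<xi> < r" "(G has_real_derivative 0) (at \<xi>)"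
    using Rolle[OF lr(1)] by blast
  then have "G' \<xi> = 0" using G_at DERIV_unique by blast
  then have "(t - \<xi>) * (2 * \<psi> s - \<phi>'' \<xi> * (t - s)\<^sup>2) = 0" by (simp add: G'_def algebra_simps)
  moreover have "t \<noteq> \<xi>" using \<xi> by (auto simp: l_def r_def min_def max_def split: if_splits)
  ultimately have "\<psi> s = \<phi>'' \<xi> * (t - s)\<^sup>2 / 2" by simp
  then show ?thesis
    using \<xi> by (intro bexI[of _ \<xi>]) (auto simp: \<psi>_def l_def r_def)
qed

section \<open>Form bounds for \<open>P\<close> and dual-norm bounds for residuals\<close>

section \<open>The averaged resolvent of the scheme\<close>

text \<open>The resolvent parameter comes from multiplying the equation for the component
  \<open>j\<close> by \<open>\<tau>\<^sup>2 / \<eta> j\<close>.\<close>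

locale resolvent_splitting =
  fixes J :: "'i set" and Ds :: "'i \<Rightarrow> 'a::real_inner set" and As R :: "'i \<Rightarrow> 'a \<Rightarrow> 'a"
    and \<eta> :: "'i \<Rightarrow> real" and \<tau> :: real
  assumes finite: "finite J" and \<tau>_pos: "\<tau> > 0"
    and \<eta>_pos: "\<And>j. j \<in> J \<Longrightarrow> \<eta> j > 0" and \<eta>_sum: "(\<Sum>j\<in>J. \<eta> j) = 1"
    and resolvent: "\<And>j. j \<in> J \<Longrightarrow> nonneg_resolvent (Ds j) (As j) (\<tau>\<^sup>2 / \<eta> j) (R j)"
begin

definition P :: "'a \<Rightarrow> 'a" where
  "P y = (\<Sum>j\<in>J. \<eta> j *\<^sub>R (y - R j y))"

lemmas R_linear = nonneg_resolvent.linear_R[OF resolvent]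

lemma linear_P: "linear P"
proof
  fix x y r
  show "P (x + y) = P x + P y"
    unfolding P_def sum.distrib[symmetric]
    by (intro sum.cong refl) (simp add: linear_add[OF R_linear] algebra_simps)
  show "P (r *\<^sub>R x) = r *\<^sub>R P x"
    unfolding P_def scaleR_sum_right
    by (intro sum.cong refl) (simp add: linear_scale[OF R_linear] scaleR_diff_right mult.commute)
qed

lemma P_eq: "P y = y - (\<Sum>j\<in>J. \<eta> j *\<^sub>R R j y)"
  by (simp add: P_def scaleR_diff_right sum_subtractf flip: scaleR_sum_left) (simp add: \<eta>_sum)

lemma P_symmetric: "P x \<bullet> y = x \<bullet> P y"
  unfolding P_def inner_sum_left inner_sum_right
  by (intro sum.cong refl)
    (simp add: inner_diff_left inner_diff_right nonneg_resolvent.R_symmetric[OF resolvent])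

lemma P_inner: "P y \<bullet> y = (\<Sum>j\<in>J. \<eta> j * ((y - R j y) \<bullet> y))"
  by (simp add: P_def inner_sum_left)

lemma compl_nonneg: "j \<in> J \<Longrightarrow> 0 \<le> (y - R j y) \<bullet> y"
  using nonneg_resolvent.compl_norm_le[OF resolvent, of j y] zero_le_power2 order_trans by blast

lemma compl_le_P_inner:
  assumes "j \<in> J"
  shows "\<eta> j * ((y - R j y) \<bullet> y) \<le> P y \<bullet> y"
  unfolding P_inner using assms finite \<eta>_pos compl_nonneg
  by (intro member_le_sum) (auto intro!: mult_nonneg_nonneg simp: less_imp_le)

text \<open>The bound \<open>compl_norm_le\<close> for each \<open>I - R j\<close> survives
  averaging: as the weights sum to 1, Young's inequality leaves half of
  \<open>(norm (P y))\<^sup>2\<close> to be absorbed.\<close>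

lemma norm_P_le: "(norm (P y))\<^sup>2 \<le> P y \<bullet> y"
proof -
  have "(norm (P y))\<^sup>2 = (\<Sum>j\<in>J. \<eta> j * ((y - R j y) \<bullet> P y))"
    unfolding power2_norm_eq_inner by (subst (1) P_def) (simp add: inner_sum_left)
  also have "\<dots> \<le> (\<Sum>j\<in>J. \<eta> j * (((y - R j y) \<bullet> y + (norm (P y))\<^sup>2) / 2))"
  proof (intro sum_mono mult_left_mono)
    fix j assume j: "j \<in> J"
    have "0 \<le> (norm ((y - R j y) - P y))\<^sup>2" by simp
    also have "\<dots> = (norm (y - R j y))\<^sup>2 - 2 * ((y - R j y) \<bullet> P y) + (norm (P y))\<^sup>2"
      unfolding power2_norm_eq_inner inner_diff_left[of _ "P y"] inner_diff_right[of _ _ "P y"]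
      by (simp add: inner_commute)
    finally show "(y - R j y) \<bullet> P y \<le> ((y - R j y) \<bullet> y + (norm (P y))\<^sup>2) / 2"
      using nonneg_resolvent.compl_norm_le[OF resolvent[OF j], of y] by simp
  qed (use \<eta>_pos in \<open>auto intro: less_imp_le\<close>)
  also have "\<dots> = (P y \<bullet> y) / 2 + (\<Sum>j\<in>J. \<eta> j) * (norm (P y))\<^sup>2 / 2"
    unfolding P_inner sum_distrib_right sum_divide_distrib sum.distrib[symmetric]
    by (intro sum.cong refl) (simp add: field_simps)
  finally show ?thesis by (simp add: \<eta>_sum)
qed

lemma P_nonneg: "0 \<le> P y \<bullet> y"
  using norm_P_le[of y] zero_le_power2 order_trans by blast

text \<open>Symmetry moves \<open>I - R j\<close> to \<open>y\<close>; there the squared norm is at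
  most the form, and \<open>\<eta> j\<close> times the form is one of the nonnegative summands of
  \<open>P y \<bullet> y\<close>.\<close>

lemma compl_inner_bound:
  assumes j: "j \<in> J"
  shows "(x - R j x) \<bullet> y \<le> norm x / sqrt (\<eta> j) * sqrt (P y \<bullet> y)"
proof -
  have "(x - R j x) \<bullet> y = x \<bullet> (y - R j y)"
    by (simp add: inner_diff_left inner_diff_right nonneg_resolvent.R_symmetric[OF resolvent[OF j]])
  also have "\<dots> \<le> norm x * norm (y - R j y)" by (rule norm_cauchy_schwarz)
  also have "norm (y - R j y) \<le> sqrt ((P y \<bullet> y) / \<eta> j)"
  proof (rule real_le_rsqrt)
    have "(norm (y - R j y))\<^sup>2 \<le> (y - R j y) \<bullet> y"
      by (rule nonneg_resolvent.compl_norm_le[OF resolvent[OF j]])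
    also have "\<dots> \<le> (P y \<bullet> y) / \<eta> j"
      using compl_le_P_inner[OF j, of y] \<eta>_pos[OF j] by (simp add: field_simps)
    finally show "(norm (y - R j y))\<^sup>2 \<le> (P y \<bullet> y) / \<eta> j" .
  qed
  finally show ?thesis by (simp add: real_sqrt_divide mult_left_mono)
qed

lemma P_inner_domain_le:
  assumes "\<And>j. j \<in> J \<Longrightarrow> x \<in> Ds j"
  shows "P x \<bullet> x \<le> \<tau>\<^sup>2 * ((\<Sum>j\<in>J. As j x) \<bullet> x)"
proof -
  have "P x \<bullet> x \<le> (\<Sum>j\<in>J. \<eta> j * (\<tau>\<^sup>2 / \<eta> j * (As j x \<bullet> x)))"
    unfolding P_inner using assms \<eta>_pos
    by (intro sum_mono mult_left_mono nonneg_resolvent.compl_inner_le[OF resolvent]) (auto intro: less_imp_le)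
  also have "\<dots> = (\<Sum>j\<in>J. \<tau>\<^sup>2 * (As j x \<bullet> x))"
    using \<eta>_pos by (intro sum.cong refl) (simp add: less_imp_neq[symmetric])
  finally show ?thesis by (simp add: sum_distrib_left inner_sum_left)
qed

lemma P_domain:
  assumes "\<And>j. j \<in> J \<Longrightarrow> x \<in> Ds j"
  shows "P x = \<tau>\<^sup>2 *\<^sub>R (\<Sum>j\<in>J. R j (As j x))"
  unfolding P_def scaleR_sum_right
proof (rule sum.cong[OF refl])
  fix j assume j: "j \<in> J"
  show "\<eta> j *\<^sub>R (x - R j x) = \<tau>\<^sup>2 *\<^sub>R R j (As j x)"
    using nonneg_resolvent.compl_domain[OF resolvent[OF j] assms[OF j]] \<eta>_pos[OF j] by simp
qed

text \<open>One coercive component is enough, as the others contribute nonnegative terms.\<close>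

lemma P_coercive:
  assumes j: "j \<in> J" and b: "bounded_below_by \<alpha> (Ds j) (As j)"
    and m: "0 \<le> m" "m \<le> \<tau>\<^sup>2 / \<eta> j * \<alpha>" "m \<le> 1"
  shows "\<eta> j * m / 2 * (norm y)\<^sup>2 \<le> P y \<bullet> y"
proof -
  have "\<eta> j * (m / 2 * (norm y)\<^sup>2) \<le> \<eta> j * ((y - R j y) \<bullet> y)"
    using nonneg_resolvent.compl_coercive[OF resolvent[OF j] b m] \<eta>_pos[OF j]
    by (intro mult_left_mono) auto
  also have "\<dots> \<le> P y \<bullet> y" by (rule compl_le_P_inner[OF j])
  finally show ?thesis by simp
qed

lemmas P_Cauchy_Schwarz = psd_Cauchy_Schwarz[OF linear_P P_symmetric P_nonneg]

text \<open>\<open>w\<close> will be the extrapolated value and \<open>x\<close> the solution at a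
  nearby time. As \<open>P x\<close> is explicit, the difference consists of
  \<open>P (w - x)\<close>, controlled by the energy form, and terms
  \<open>(I - R j) (As j x)\<close>, controlled by \<open>compl_inner_bound\<close>.\<close>

lemma weak_consistency:
  assumes x: "\<And>j. j \<in> J \<Longrightarrow> x \<in> Ds j" and wx: "\<And>j. j \<in> J \<Longrightarrow> w - x \<in> Ds j"
  shows "(P w - \<tau>\<^sup>2 *\<^sub>R (\<Sum>j\<in>J. As j x)) \<bullet> y \<le>
    (\<tau> * sqrt ((\<Sum>j\<in>J. As j (w - x)) \<bullet> (w - x)) + \<tau>\<^sup>2 * (\<Sum>j\<in>J. norm (As j x) / sqrt (\<eta> j)))
      * sqrt (P y \<bullet> y)"
proof -
  have "P w - \<tau>\<^sup>2 *\<^sub>R (\<Sum>j\<in>J. As j x) = P (w - x) - \<tau>\<^sup>2 *\<^sub>R (\<Sum>j\<in>J. As j x - R j (As j x))"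
    using P_domain[OF x] by (simp add: linear_diff[OF linear_P] sum_subtractf scaleR_diff_right)
  then have "(P w - \<tau>\<^sup>2 *\<^sub>R (\<Sum>j\<in>J. As j x)) \<bullet> y =
      P (w - x) \<bullet> y + \<tau>\<^sup>2 * (\<Sum>j\<in>J. - ((As j x - R j (As j x)) \<bullet> y))"
    by (simp add: inner_diff_left inner_sum_left sum_negf sum_subtractf right_diff_distrib)
  also have "\<dots> \<le> (\<tau> * sqrt ((\<Sum>j\<in>J. As j (w - x)) \<bullet> (w - x))) * sqrt (P y \<bullet> y) +
      \<tau>\<^sup>2 * (\<Sum>j\<in>J. norm (As j x) / sqrt (\<eta> j) * sqrt (P y \<bullet> y))"
  proof (intro add_mono mult_left_mono sum_mono)
    have "sqrt (P (w - x) \<bullet> (w - x)) \<le> \<tau> * sqrt ((\<Sum>j\<in>J. As j (w - x)) \<bullet> (w - x))"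
      using real_sqrt_le_mono[OF P_inner_domain_le[OF wx]] \<tau>_pos by (simp add: real_sqrt_mult)
    then have "sqrt (P (w - x) \<bullet> (w - x)) * sqrt (P y \<bullet> y) \<le>
        (\<tau> * sqrt ((\<Sum>j\<in>J. As j (w - x)) \<bullet> (w - x))) * sqrt (P y \<bullet> y)"
      using P_nonneg by (intro mult_right_mono) auto
    then show "P (w - x) \<bullet> y \<le>
        (\<tau> * sqrt ((\<Sum>j\<in>J. As j (w - x)) \<bullet> (w - x))) * sqrt (P y \<bullet> y)"
      using P_Cauchy_Schwarz[of "w - x" y] by linarith
    fix j assume j: "j \<in> J"
    have "- ((As j x - R j (As j x)) \<bullet> y) = (- As j x - R j (- As j x)) \<bullet> y"
      by (simp add: linear_neg[OF R_linear[OF j]] inner_diff_left)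
    also have "\<dots> \<le> norm (As j x) / sqrt (\<eta> j) * sqrt (P y \<bullet> y)"
      using compl_inner_bound[OF j, of "- As j x" y] by simp
    finally show "- ((As j x - R j (As j x)) \<bullet> y) \<le> norm (As j x) / sqrt (\<eta> j) * sqrt (P y \<bullet> y)" .
  qed simp
  also have "(\<Sum>j\<in>J. norm (As j x) / sqrt (\<eta> j) * sqrt (P y \<bullet> y)) =
      (\<Sum>j\<in>J. norm (As j x) / sqrt (\<eta> j)) * sqrt (P y \<bullet> y)"
    by (simp only: sum_distrib_right)
  finally show ?thesis by (simp only: distrib_right mult.assoc)
qed

text \<open>The unstructured terms \<open>r\<close> and \<open>R i q\<close> lose a factor
  \<open>1 / (\<kappa> * \<tau>)\<close> in the dual norm, whereas \<open>p - R i p\<close> loses no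
  power of \<open>\<tau>\<close>.\<close>

lemma weak_residual_bound:
  assumes x: "\<And>j. j \<in> J \<Longrightarrow> x \<in> Ds j" and wx: "\<And>j. j \<in> J \<Longrightarrow> w - x \<in> Ds j"
    and i: "i \<in> J" and \<kappa>: "\<kappa> > 0" "\<And>y. (\<kappa> * \<tau>)\<^sup>2 * (norm y)\<^sup>2 \<le> P y \<bullet> y"
    and b: "(\<Sum>j\<in>J. As j (w - x)) \<bullet> (w - x) \<le> b\<^sup>2" "b \<ge> 0"
    and K: "\<And>j. j \<in> J \<Longrightarrow> norm (As j x) \<le> K"
    and p: "norm p \<le> K'" and r: "norm r \<le> r'" and q: "norm q \<le> q'"
  shows "(P w - \<tau>\<^sup>2 *\<^sub>R (\<Sum>j\<in>J. As j x) + \<tau>\<^sup>2 *\<^sub>R (r + (p - R i p) + R i q)) \<bullet> y \<le>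
    \<tau> * (b + \<tau> * (K * (\<Sum>j\<in>J. 1 / sqrt (\<eta> j)) + K' / sqrt (\<eta> i)) + (r' + q') / \<kappa>)
      * sqrt (P y \<bullet> y)"
proof -
  let ?s = "sqrt (P y \<bullet> y)"
  have s: "?s \<ge> 0" using P_nonneg by simp
  have "(\<tau> * sqrt ((\<Sum>j\<in>J. As j (w - x)) \<bullet> (w - x)) + \<tau>\<^sup>2 * (\<Sum>j\<in>J. norm (As j x) / sqrt (\<eta> j)))
      \<le> \<tau> * b + \<tau>\<^sup>2 * (\<Sum>j\<in>J. K / sqrt (\<eta> j))"
    using real_sqrt_le_mono[OF b(1)] b(2) \<tau>_pos K \<eta>_pos
    by (intro add_mono mult_left_mono sum_mono divide_right_mono) (auto intro: less_imp_le)
  then have 1: "(P w - \<tau>\<^sup>2 *\<^sub>R (\<Sum>j\<in>J. As j x)) \<bullet> y \<le> (\<tau> * b + \<tau>\<^sup>2 * (\<Sum>j\<in>J. K / sqrt (\<eta> j))) * ?s"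
    using weak_consistency[OF x wx, of y] s by (meson mult_right_mono order_trans)
  have 2: "(p - R i p) \<bullet> y \<le> K' / sqrt (\<eta> i) * ?s"
    using compl_inner_bound[OF i, of p y] p s \<eta>_pos[OF i]
    by (meson divide_right_mono less_imp_le mult_right_mono order_trans real_sqrt_gt_0_iff)
  have "\<kappa> * \<tau> * norm y \<le> ?s"
    using \<kappa>(2)[of y] \<kappa>(1) \<tau>_pos by (intro real_le_rsqrt) (simp add: power_mult_distrib)
  then have y: "norm y \<le> ?s / (\<kappa> * \<tau>)" using \<kappa>(1) \<tau>_pos by (simp add: field_simps)
  have "(r + R i q) \<bullet> y \<le> norm (r + R i q) * norm y" by (rule norm_cauchy_schwarz)
  also have "norm (r + R i q) \<le> r' + q'"
    using norm_triangle_ineq[of r "R i q"] nonneg_resolvent.norm_R_le[OF resolvent[OF i], of q] r q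
    by linarith
  also have "(r' + q') * norm y \<le> (r' + q') * (?s / (\<kappa> * \<tau>))"
    using y r q norm_ge_zero order_trans by (intro mult_left_mono) (blast intro: add_nonneg_nonneg)+
  finally have 3: "(r + R i q) \<bullet> y \<le> (r' + q') * (?s / (\<kappa> * \<tau>))"
    by (simp add: mult_right_mono)
  have "(P w - \<tau>\<^sup>2 *\<^sub>R (\<Sum>j\<in>J. As j x) + \<tau>\<^sup>2 *\<^sub>R (r + (p - R i p) + R i q)) \<bullet> y
      = (P w - \<tau>\<^sup>2 *\<^sub>R (\<Sum>j\<in>J. As j x)) \<bullet> y + \<tau>\<^sup>2 * ((p - R i p) \<bullet> y) + \<tau>\<^sup>2 * ((r + R i q) \<bullet> y)"
    by (simp add: inner_add_left inner_diff_left algebra_simps)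
  also have "\<dots> \<le> (\<tau> * b + \<tau>\<^sup>2 * (\<Sum>j\<in>J. K / sqrt (\<eta> j))) * ?s + \<tau>\<^sup>2 * (K' / sqrt (\<eta> i) * ?s)
      + \<tau>\<^sup>2 * ((r' + q') * (?s / (\<kappa> * \<tau>)))"
    using 1 2 3 by (intro add_mono mult_left_mono) auto
  also have "\<tau>\<^sup>2 * ((r' + q') * (?s / (\<kappa> * \<tau>))) = \<tau> * ((r' + q') / \<kappa>) * ?s"
    using \<tau>_pos \<kappa>(1) by (simp add: field_simps power2_eq_square)
  also have "(\<Sum>j\<in>J. K / sqrt (\<eta> j)) = K * (\<Sum>j\<in>J. 1 / sqrt (\<eta> j))"
    by (simp add: sum_distrib_left)
  also have "(\<tau> * b + \<tau>\<^sup>2 * (K * (\<Sum>j\<in>J. 1 / sqrt (\<eta> j)))) * ?s + \<tau>\<^sup>2 * (K' / sqrt (\<eta> i) * ?s)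
      + \<tau> * ((r' + q') / \<kappa>) * ?s =
    \<tau> * (b + \<tau> * (K * (\<Sum>j\<in>J. 1 / sqrt (\<eta> j)) + K' / sqrt (\<eta> i)) + (r' + q') / \<kappa>) * ?s"
    by (simp add: distrib_left distrib_right power2_eq_square)
  finally show ?thesis .
qed

text \<open>One step of the scheme, written with \<open>w = 2 v\<^sub>k - v\<^sub>k\<^sub>-\<^sub>1\<close>.\<close>
lemma scheme_value:
  assumes i: "i \<in> J" and y: "\<And>j. j \<in> J \<Longrightarrow> y j \<in> Ds j"
    and eq: "\<And>j. j \<in> J \<Longrightarrow> \<eta> j *\<^sub>R ((y j - w) /\<^sub>R \<tau>\<^sup>2) + As j (y j) = (if j = i then F else 0)"
  shows "(\<Sum>j\<in>J. \<eta> j *\<^sub>R y j) = w - P w + \<tau>\<^sup>2 *\<^sub>R R i F"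
proof -
  have "y j = R j w + (if j = i then (\<tau>\<^sup>2 / \<eta> j) *\<^sub>R R i F else 0)" if j: "j \<in> J" for j
  proof -
    have "(\<tau>\<^sup>2 / \<eta> j) *\<^sub>R (\<eta> j *\<^sub>R ((y j - w) /\<^sub>R \<tau>\<^sup>2) + As j (y j)) = y j - w + (\<tau>\<^sup>2 / \<eta> j) *\<^sub>R As j (y j)"
      using \<tau>_pos \<eta>_pos[OF j] by (simp add: scaleR_add_right)
    then have "y j + (\<tau>\<^sup>2 / \<eta> j) *\<^sub>R As j (y j) = w + (\<tau>\<^sup>2 / \<eta> j) *\<^sub>R (if j = i then F else 0)"
      unfolding eq[OF j] by (simp add: algebra_simps)
    then have "y j = R j (w + (\<tau>\<^sup>2 / \<eta> j) *\<^sub>R (if j = i then F else 0))"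
      using nonneg_resolvent.left_inverse[OF resolvent[OF j] y[OF j]] by simp
    then show ?thesis
      using R_linear[OF j] by (simp add: linear_add linear_scale linear_0)
  qed
  \<comment> \<open>Only \<open>j = i\<close> carries the source, and \<open>\<eta> i\<close>
    cancels the denominator of the resolvent parameter.\<close>
  then have "(\<Sum>j\<in>J. \<eta> j *\<^sub>R y j) = (\<Sum>j\<in>J. \<eta> j *\<^sub>R R j w + (if j = i then \<tau>\<^sup>2 *\<^sub>R R i F else 0))"
    using \<eta>_pos by (intro sum.cong refl) (auto simp: scaleR_add_right less_imp_neq[symmetric])
  then show ?thesis
    using finite i by (simp add: sum.distrib P_eq)
qed

end

section \<open>Residual of the exact solution and the Gronwall argument\<close>

section \<open>The error of the scheme\<close>

text \<open>A vector-valued remainder need not have a single intermediate point; its pairing with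
  \<open>y\<close> has one. Dependence on \<open>y\<close> is harmless, as residuals are only
  estimated in the dual norm.\<close>

lemma Taylor2_inner_within:
  fixes u u' u'' :: "real \<Rightarrow> 'a::real_inner"
  assumes u: "\<And>t. t \<in> {p..q} \<Longrightarrow> (u has_vector_derivative u' t) (at t within {p..q})"
    and u': "\<And>t. t \<in> {p..q} \<Longrightarrow> (u' has_vector_derivative u'' t) (at t within {p..q})"
    and st: "s \<in> {p..q}" "t \<in> {p..q}" "s \<noteq> t"
  shows "\<exists>\<xi>\<in>{min s t..max s t}. (u t - u s - (t - s) *\<^sub>R u' s) \<bullet> y = (t - s)\<^sup>2 / 2 * (u'' \<xi> \<bullet> y)"
proof -
  have d: "((\<lambda>t. w t \<bullet> y) has_real_derivative w' \<bullet> y) (at t within {p..q})"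
    if "(w has_vector_derivative w') (at t within {p..q})" for w :: "real \<Rightarrow> 'a" and w' t
    unfolding has_real_derivative_iff_has_vector_derivative
    by (rule bounded_linear.has_vector_derivative[OF bounded_linear_inner_left that])
  obtain \<xi> where "\<xi> \<in> {min s t..max s t}"
    "u t \<bullet> y = u s \<bullet> y + (u' s \<bullet> y) * (t - s) + (u'' \<xi> \<bullet> y) * (t - s)\<^sup>2 / 2"
    using Taylor2_within[of p q "\<lambda>t. u t \<bullet> y" "\<lambda>t. u' t \<bullet> y" "\<lambda>t. u'' t \<bullet> y",
        OF d[OF u] d[OF u'] st] by blast
  then show ?thesis
    by (intro bexI[of _ \<xi>]) (auto simp: inner_diff_left algebra_simps)
qed

text \<open>\<open>B\<close> stands for the square root of the sum of the \<open>As j\<close>;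
  \<open>\<kappa>\<close> measures the coercivity of \<open>P\<close>; the capital constants are
  Hoelder constants and bounds along the solution.\<close>

locale splitting_error = resolvent_splitting J Ds As R \<eta> \<tau>
  for J :: "'i set" and Ds :: "'i \<Rightarrow> 'a::{real_inner, complete_space} set"
    and As R :: "'i \<Rightarrow> 'a \<Rightarrow> 'a" and \<eta> :: "'i \<Rightarrow> real" and \<tau> :: real +
  fixes i :: 'i and B M :: "'a \<Rightarrow> 'a" and f u u' u'' :: "real \<Rightarrow> 'a"
    and T \<nu> \<kappa> a C\<^sub>B C\<^sub>f L\<^sub>1 L\<^sub>2 K K' :: real
  assumes i: "i \<in> J" and \<kappa>_pos: "\<kappa> > 0"
    and P_lower: "\<And>y. (\<kappa> * \<tau>)\<^sup>2 * (norm y)\<^sup>2 \<le> P y \<bullet> y"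
    and \<tau>_le: "\<tau> \<le> T" and \<nu>: "0 < \<nu>" "\<nu> \<le> 1"
    and B_add: "\<And>x y. (\<And>j. j \<in> J \<Longrightarrow> x \<in> Ds j) \<Longrightarrow> (\<And>j. j \<in> J \<Longrightarrow> y \<in> Ds j) \<Longrightarrow> B (x + y) = B x + B y"
    and B_diff: "\<And>x y. (\<And>j. j \<in> J \<Longrightarrow> x \<in> Ds j) \<Longrightarrow> (\<And>j. j \<in> J \<Longrightarrow> y \<in> Ds j) \<Longrightarrow> B (x - y) = B x - B y"
    and B_norm: "\<And>x. (\<And>j. j \<in> J \<Longrightarrow> x \<in> Ds j) \<Longrightarrow> (\<Sum>j\<in>J. As j x) \<bullet> x = (norm (B x))\<^sup>2"
    and B_holder: "\<And>s t. s \<in> {0..T} \<Longrightarrow> t \<in> {0..T} \<Longrightarrow> norm (B (u s) - B (u t)) \<le> C\<^sub>B * \<bar>s - t\<bar> powr \<nu>"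
    and f_holder: "\<And>s t. s \<in> {0..T} \<Longrightarrow> t \<in> {0..T} \<Longrightarrow> norm (f s - f t) \<le> C\<^sub>f * \<bar>s - t\<bar> powr \<nu>"
    and const_nonneg: "0 \<le> C\<^sub>B" "0 \<le> C\<^sub>f"
    and a_pos: "a > 0" and M_lipschitz: "\<And>x y. norm (M x - M y) \<le> a * norm (x - y)"
    and u_deriv: "\<And>t. t \<in> {0..T} \<Longrightarrow> (u has_vector_derivative u' t) (at t within {0..T})"
    and u'_deriv: "\<And>t. t \<in> {0..T} \<Longrightarrow> (u' has_vector_derivative u'' t) (at t within {0..T})"
    and u_mem: "\<And>t j. t \<in> {0..T} \<Longrightarrow> j \<in> J \<Longrightarrow> u t \<in> Ds j"
    and equation: "\<And>t. t \<in> {0..T} \<Longrightarrow> u'' t + (\<Sum>j\<in>J. As j (u t)) + M (u t) = f t"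
    and u'_le: "\<And>t. t \<in> {0..T} \<Longrightarrow> norm (u' t) \<le> L\<^sub>1"
    and u''_le: "\<And>t. t \<in> {0..T} \<Longrightarrow> norm (u'' t) \<le> L\<^sub>2"
    and As_u_le: "\<And>t j. t \<in> {0..T} \<Longrightarrow> j \<in> J \<Longrightarrow> norm (As j (u t)) \<le> K"
    and rhs_le: "\<And>t. t \<in> {0..T} \<Longrightarrow> norm (f t - M (u t)) \<le> K'"
begin

text \<open>Factor of \<open>\<tau> powr (1 + \<nu>)\<close> in the dual norm of the residual, apart
  from the contribution of \<open>u t - v\<close>; it does not contain
  \<open>\<tau>\<close>.\<close>

definition Y :: real where
  "Y = 2 * C\<^sub>B + T powr (1 - \<nu>) * (K * (\<Sum>j\<in>J. 1 / sqrt (\<eta> j)) + K' / sqrt (\<eta> i))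
     + (C\<^sub>f + a * L\<^sub>1 * T powr (1 - \<nu>)) / \<kappa>"

lemma T_pos: "T > 0" using \<tau>_pos \<tau>_le by simp

text \<open>Makes first-order terms comparable with Hoelder increments.\<close>

lemma \<tau>_le_powr: "\<tau> \<le> T powr (1 - \<nu>) * \<tau> powr \<nu>"
proof -
  have "\<tau> = \<tau> powr (1 - \<nu>) * \<tau> powr \<nu>" using \<tau>_pos by (simp flip: powr_add)
  also have "\<dots> \<le> T powr (1 - \<nu>) * \<tau> powr \<nu>"
    using \<tau>_pos \<tau>_le \<nu> by (intro mult_right_mono powr_mono2) auto
  finally show ?thesis .
qed

lemma consts_nonneg: "0 \<le> L\<^sub>1" "0 \<le> L\<^sub>2" "0 \<le> K" "0 \<le> K'"
proof -
  have 0: "0 \<in> {0..T}" using T_pos by simp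
  show "0 \<le> L\<^sub>1" by (rule order_trans[OF norm_ge_zero u'_le[OF 0]])
  show "0 \<le> L\<^sub>2" by (rule order_trans[OF norm_ge_zero u''_le[OF 0]])
  show "0 \<le> K" by (rule order_trans[OF norm_ge_zero As_u_le[OF 0 i]])
  show "0 \<le> K'" by (rule order_trans[OF norm_ge_zero rhs_le[OF 0]])
qed

lemma u_lipschitz:
  assumes "s \<in> {0..T}" "t \<in> {0..T}"
  shows "norm (u s - u t) \<le> L\<^sub>1 * \<bar>s - t\<bar>"
proof -
  have "norm (u s - u t) \<le> L\<^sub>1 * norm (s - t)"
  proof (rule differentiable_bound[OF convex_real_interval(5)])
    show "(u has_derivative (\<lambda>h. h *\<^sub>R u' x)) (at x within {0..T})" if "x \<in> {0..T}" for x
      using u_deriv[OF that] by (simp add: has_vector_derivative_def)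
    show "onorm (\<lambda>h. h *\<^sub>R u' x) \<le> L\<^sub>1" if "x \<in> {0..T}" for x
      using u'_le[OF that] by (intro onorm_le) (simp add: mult.commute[of L\<^sub>1] mult_left_mono)
  qed (use assms in auto)
  then show ?thesis by simp
qed

text \<open>Taylor expansions turn the second difference into an average of \<open>u''\<close> at
  two points. So it suffices to treat one point \<open>\<xi>\<close> within \<open>\<tau>\<close> of
  \<open>t\<close>, where the differential equation replaces \<open>u''\<close>.\<close>

lemma residual_bound:
  assumes t: "0 \<le> t - \<tau>" "t + \<tau> \<le> T"
  shows "((u (t + \<tau>) - 2 *\<^sub>R u t + u (t - \<tau>)) + P (2 *\<^sub>R u t - u (t - \<tau>)) - \<tau>\<^sup>2 *\<^sub>R R i (f t - M v)) \<bullet> y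
    \<le> \<tau> * (Y * \<tau> powr \<nu> + a / \<kappa> * norm (u t - v)) * sqrt (P y \<bullet> y)"
proof -
  define w where "w = 2 *\<^sub>R u t - u (t - \<tau>)"
  define h where "h = \<tau> powr \<nu>"
  define bound where "bound = \<tau> * (Y * h + a / \<kappa> * norm (u t - v)) * sqrt (P y \<bullet> y)"
  have mem: "t \<in> {0..T}" "t - \<tau> \<in> {0..T}" "t + \<tau> \<in> {0..T}" using t \<tau>_pos by auto
  have s: "sqrt (P y \<bullet> y) \<ge> 0" using P_nonneg by simp
  have *: "\<tau>\<^sup>2 * (u'' \<xi> \<bullet> y) + P w \<bullet> y - \<tau>\<^sup>2 * (R i (f t - M v) \<bullet> y) \<le> bound"
    if \<xi>: "\<xi> \<in> {t - \<tau>..t + \<tau>}" for \<xi>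
  proof -
    have \<xi>': "\<xi> \<in> {0..T}" "\<bar>\<xi> - t\<bar> \<le> \<tau>" using \<xi> t by auto
    have powr_le: "\<bar>x\<bar> powr \<nu> \<le> h" if "\<bar>x\<bar> \<le> \<tau>" for x
      unfolding h_def using that \<nu> by (intro powr_mono2) auto
    \<comment> \<open>\<open>p\<close> is the source along the exact solution, \<open>r\<close> its
      increment from \<open>t\<close> to \<open>\<xi>\<close>, and \<open>q\<close> the effect of
      evaluating \<open>M\<close> at \<open>v\<close> instead of \<open>u t\<close>.\<close>
    define p where "p = f t - M (u t)"
    define r where "r = (f \<xi> - f t) - (M (u \<xi>) - M (u t))"
    define q where "q = M v - M (u t)"
    have r: "norm r \<le> (C\<^sub>f + a * L\<^sub>1 * T powr (1 - \<nu>)) * h"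
    proof -
      have "norm (f \<xi> - f t) \<le> C\<^sub>f * h"
        using f_holder[OF \<xi>'(1) mem(1)] powr_le[OF \<xi>'(2)] const_nonneg
        by (meson mult_left_mono order_trans)
      moreover have "norm (M (u \<xi>) - M (u t)) \<le> a * (L\<^sub>1 * (T powr (1 - \<nu>) * h))"
      proof -
        have "norm (u \<xi> - u t) \<le> L\<^sub>1 * \<tau>"
          using u_lipschitz[OF \<xi>'(1) mem(1)] \<xi>'(2) consts_nonneg by (meson mult_left_mono order_trans)
        also have "\<dots> \<le> L\<^sub>1 * (T powr (1 - \<nu>) * h)"
          unfolding h_def using \<tau>_le_powr consts_nonneg by (intro mult_left_mono) auto
        finally show ?thesis using M_lipschitz[of "u \<xi>" "u t"] a_pos
          by (meson mult_left_mono order_trans less_imp_le)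
      qed
      ultimately show ?thesis
        unfolding r_def using norm_triangle_ineq4[of "f \<xi> - f t" "M (u \<xi>) - M (u t)"]
        by (simp add: algebra_simps)
    qed
    have q: "norm q \<le> a * norm (u t - v)"
      using M_lipschitz[of v "u t"] by (simp add: q_def norm_minus_commute)
    \<comment> \<open>The extrapolation error is a sum of two increments of \<open>u\<close> over
      time spans of at most \<open>\<tau>\<close>, whence the factor 2 in front of
      \<open>C\<^sub>B\<close>.\<close>
    have wx: "w - u \<xi> = (u t - u (t - \<tau>)) + (u t - u \<xi>)" by (simp add: w_def scaleR_2)
    have diff_mem: "x - x' \<in> Ds j" if "x \<in> Ds j" "x' \<in> Ds j" "j \<in> J" for x x' j
      using self_adjoint_operator_diff(1) nonneg_resolvent.self_adjoint[OF resolvent] that by blast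
    have wx_mem: "w - u \<xi> \<in> Ds j" if j: "j \<in> J" for j
      unfolding wx using mem \<xi>'(1) u_mem j diff_mem
      by (intro subspace_add[OF nonneg_resolvent.domain(1)[OF resolvent[OF j]]]) auto
    have "B (w - u \<xi>) = (B (u t) - B (u (t - \<tau>))) + (B (u t) - B (u \<xi>))"
      unfolding wx using u_mem diff_mem mem \<xi>'(1) by (simp add: B_add B_diff)
    also have "norm \<dots> \<le> C\<^sub>B * h + C\<^sub>B * h"
    proof (intro order_trans[OF norm_triangle_ineq] add_mono)
      show "norm (B (u t) - B (u (t - \<tau>))) \<le> C\<^sub>B * h"
        using B_holder[OF mem(1,2)] powr_le[of \<tau>] \<tau>_pos const_nonneg by (simp add: h_def)
      show "norm (B (u t) - B (u \<xi>)) \<le> C\<^sub>B * h"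
        using B_holder[OF mem(1) \<xi>'(1)] powr_le[of "t - \<xi>"] \<xi>'(2) const_nonneg
        by (smt (verit) mult_left_mono abs_minus_commute)
    qed
    finally have Bw: "norm (B (w - u \<xi>)) \<le> 2 * C\<^sub>B * h" by simp
    have form: "(\<Sum>j\<in>J. As j (w - u \<xi>)) \<bullet> (w - u \<xi>) \<le> (2 * C\<^sub>B * h)\<^sup>2"
      using power_mono[OF Bw norm_ge_zero, of 2] B_norm[OF wx_mem] by simp
    have u'': "u'' \<xi> = f \<xi> - M (u \<xi>) - (\<Sum>j\<in>J. As j (u \<xi>))"
      using equation[OF \<xi>'(1)] by (simp add: algebra_simps)
    have pq: "R i (f t - M v) = R i p - R i q"
      by (simp add: linear_diff[OF R_linear[OF i], symmetric] p_def q_def)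
    \<comment> \<open>The source at \<open>\<xi>\<close> is \<open>p + r\<close>; subtracting
      \<open>R i p\<close> leaves the cheap term \<open>p - R i p\<close>.\<close>
    have "\<tau>\<^sup>2 *\<^sub>R u'' \<xi> + P w - \<tau>\<^sup>2 *\<^sub>R R i (f t - M v) =
        P w - \<tau>\<^sup>2 *\<^sub>R (\<Sum>j\<in>J. As j (u \<xi>)) + \<tau>\<^sup>2 *\<^sub>R (r + (p - R i p) + R i q)"
      unfolding pq u'' by (simp add: p_def r_def algebra_simps)
    then have "\<tau>\<^sup>2 * (u'' \<xi> \<bullet> y) + P w \<bullet> y - \<tau>\<^sup>2 * (R i (f t - M v) \<bullet> y) =
        (P w - \<tau>\<^sup>2 *\<^sub>R (\<Sum>j\<in>J. As j (u \<xi>)) + \<tau>\<^sup>2 *\<^sub>R (r + (p - R i p) + R i q)) \<bullet> y"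
      by (metis inner_add_left inner_diff_left inner_scaleR_left)
    also have "\<dots> \<le> \<tau> * (2 * C\<^sub>B * h + \<tau> * (K * (\<Sum>j\<in>J. 1 / sqrt (\<eta> j)) + K' / sqrt (\<eta> i))
        + ((C\<^sub>f + a * L\<^sub>1 * T powr (1 - \<nu>)) * h + a * norm (u t - v)) / \<kappa>) * sqrt (P y \<bullet> y)"
      using const_nonneg \<xi>'(1) mem(1)
      by (intro weak_residual_bound wx_mem i \<kappa>_pos P_lower form r q)
        (auto simp: h_def p_def intro: u_mem As_u_le rhs_le)
    also have "\<dots> \<le> bound"
      unfolding bound_def
    proof (intro mult_right_mono[OF _ s] mult_left_mono)
      have "0 \<le> K * (\<Sum>j\<in>J. 1 / sqrt (\<eta> j)) + K' / sqrt (\<eta> i)"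
        using consts_nonneg \<eta>_pos i
        by (intro add_nonneg_nonneg mult_nonneg_nonneg sum_nonneg divide_nonneg_nonneg) (auto intro: less_imp_le)
      then have "\<tau> * (K * (\<Sum>j\<in>J. 1 / sqrt (\<eta> j)) + K' / sqrt (\<eta> i)) \<le>
          (T powr (1 - \<nu>) * h) * (K * (\<Sum>j\<in>J. 1 / sqrt (\<eta> j)) + K' / sqrt (\<eta> i))"
        unfolding h_def using \<tau>_le_powr by (intro mult_right_mono) auto
      then show "2 * C\<^sub>B * h + \<tau> * (K * (\<Sum>j\<in>J. 1 / sqrt (\<eta> j)) + K' / sqrt (\<eta> i))
          + ((C\<^sub>f + a * L\<^sub>1 * T powr (1 - \<nu>)) * h + a * norm (u t - v)) / \<kappa>
          \<le> Y * h + a / \<kappa> * norm (u t - v)"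
        unfolding Y_def by (simp add: add_divide_distrib distrib_left distrib_right algebra_simps)
    qed (use \<tau>_pos in simp)
    finally show ?thesis .
  qed
  \<comment> \<open>Both expansions start from \<open>t\<close>, so the first-order terms cancel in
    the sum.\<close>
  obtain \<xi>1 where \<xi>1: "\<xi>1 \<in> {min t (t + \<tau>)..max t (t + \<tau>)}"
    "(u (t + \<tau>) - u t - (t + \<tau> - t) *\<^sub>R u' t) \<bullet> y = (t + \<tau> - t)\<^sup>2 / 2 * (u'' \<xi>1 \<bullet> y)"
    using Taylor2_inner_within[OF u_deriv u'_deriv mem(1,3), of y] \<tau>_pos by auto
  obtain \<xi>2 where \<xi>2: "\<xi>2 \<in> {min t (t - \<tau>)..max t (t - \<tau>)}"
    "(u (t - \<tau>) - u t - (t - \<tau> - t) *\<^sub>R u' t) \<bullet> y = (t - \<tau> - t)\<^sup>2 / 2 * (u'' \<xi>2 \<bullet> y)"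
    using Taylor2_inner_within[OF u_deriv u'_deriv mem(1,2), of y] \<tau>_pos by auto
  have "\<xi>1 \<in> {t - \<tau>..t + \<tau>}" "\<xi>2 \<in> {t - \<tau>..t + \<tau>}" using \<xi>1(1) \<xi>2(1) \<tau>_pos by auto
  from *[OF this(1)] *[OF this(2)]
  have "\<tau>\<^sup>2 / 2 * (u'' \<xi>1 \<bullet> y) + \<tau>\<^sup>2 / 2 * (u'' \<xi>2 \<bullet> y) + P w \<bullet> y - \<tau>\<^sup>2 * (R i (f t - M v) \<bullet> y) \<le> bound"
    by linarith
  moreover have "(u (t + \<tau>) - 2 *\<^sub>R u t + u (t - \<tau>)) \<bullet> y = \<tau>\<^sup>2 / 2 * (u'' \<xi>1 \<bullet> y) + \<tau>\<^sup>2 / 2 * (u'' \<xi>2 \<bullet> y)"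
    using \<xi>1(2) \<xi>2(2) by (simp add: inner_diff_left inner_add_left)
  ultimately show ?thesis
    by (simp add: bound_def w_def h_def inner_add_left inner_diff_left)
qed

text \<open>The errors satisfy the homogeneous scheme with the residual as right-hand side. The
  first energy root is of order \<open>\<tau>\<close>, and \<open>real n * \<tau> = T\<close> keeps
  the Gronwall exponent fixed.\<close>

lemma error_bound:
  fixes v :: "nat \<Rightarrow> 'a"
  assumes n: "real n * \<tau> = T" and v0: "v 0 = u 0" and v1: "v 1 = u 0 + \<tau> *\<^sub>R u' 0"
    and step: "\<And>k. 1 \<le> k \<Longrightarrow> k < n \<Longrightarrow> v (Suc k) = (2 *\<^sub>R v k - v (k - 1)) - P (2 *\<^sub>R v k - v (k - 1))
        + \<tau>\<^sup>2 *\<^sub>R R i (f (real k * \<tau>) - M (v k))"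
    and k: "k \<le> n"
  shows "norm (u (real k * \<tau>) - v k) \<le>
    exp (2 * a * T / \<kappa>) * (L\<^sub>2 * T powr (1 - \<nu>) / (2 * \<kappa>) + Y * \<kappa> / a) * \<tau> powr \<nu>"
proof -
  define h where "h = \<tau> powr \<nu>"
  define z where "z k = u (real k * \<tau>) - v k" for k
  \<comment> \<open>The lower bound degenerates as \<open>\<tau>\<close> tends to 0, but for fixed
    \<open>\<tau>\<close> it suffices to solve \<open>P q = x\<close>.\<close>
  have P_surj: "P ` UNIV = UNIV"
    using P_lower \<kappa>_pos \<tau>_pos
    by (intro self_adjoint_operator_surj[OF self_adjoint_operator_UNIV[OF linear_P P_symmetric], of "(\<kappa> * \<tau>)\<^sup>2"])
      (auto simp: bounded_below_by_def)
  then have "\<exists>q. P q = x" for x by (metis UNIV_I imageE)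
  then obtain Q where Q: "\<And>x. P (Q x) = x" by metis
  \<comment> \<open>Truncated subtraction makes the difference 0 at \<open>k = 0\<close>; the
    recursion below starts at \<open>k = 1\<close>.\<close>
  define q where "q k = Q (z k - z (k - 1))" for k
  have Pq: "P (q k) = z k - z (k - 1)" for k by (simp add: q_def Q)
  define e where "e k = sqrt (dual_energy P (q k) (z k))" for k
  have z_le: "norm (z k) \<le> e k" for k
    unfolding e_def by (rule norm_le_sqrt_dual_energy[OF norm_P_le])
  then have e_nonneg: "0 \<le> e k" for k using norm_ge_zero order_trans by blast
  have Y_nonneg: "0 \<le> Y"
    unfolding Y_def using const_nonneg consts_nonneg a_pos \<kappa>_pos \<eta>_pos i
    by (intro add_nonneg_nonneg mult_nonneg_nonneg sum_nonneg divide_nonneg_nonneg) (auto intro: less_imp_le)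
  have n_pos: "n > 0" using n T_pos by (cases n) auto
  have z0: "z 0 = 0" by (simp add: z_def v0)
  have e1: "e 1 \<le> L\<^sub>2 * T powr (1 - \<nu>) / (2 * \<kappa>) * h"
  proof -
    let ?s = "sqrt (P (q 1) \<bullet> q 1)"
    have Pq1: "P (q 1) = z 1" using Pq[of 1] z0 by simp
    \<comment> \<open>As \<open>z 0 = 0\<close>, two squares cancel, and the first energy root is
      the dual norm of the Taylor remainder \<open>z 1\<close>.\<close>
    have e1: "e 1 = ?s" unfolding e_def dual_energy_def Pq1 by simp
    obtain \<xi> where \<xi>: "\<xi> \<in> {min 0 \<tau>..max 0 \<tau>}"
      "(u \<tau> - u 0 - (\<tau> - 0) *\<^sub>R u' 0) \<bullet> q 1 = (\<tau> - 0)\<^sup>2 / 2 * (u'' \<xi> \<bullet> q 1)"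
      using Taylor2_inner_within[OF u_deriv u'_deriv, of 0 \<tau> "q 1"] \<tau>_pos \<tau>_le by auto
    have \<xi>_mem: "\<xi> \<in> {0..T}" using \<xi>(1) \<tau>_pos \<tau>_le by auto
    have "(\<kappa> * \<tau> * norm (q 1))\<^sup>2 \<le> P (q 1) \<bullet> q 1"
      using P_lower[of "q 1"] by (simp add: power_mult_distrib)
    then have q1: "\<kappa> * \<tau> * norm (q 1) \<le> ?s" by (rule real_le_rsqrt)
    have "?s * ?s = P (q 1) \<bullet> q 1" using P_nonneg[of "q 1"] by simp
    also have "\<dots> = z 1 \<bullet> q 1" by (simp only: Pq1)
    also have "z 1 = u \<tau> - u 0 - (\<tau> - 0) *\<^sub>R u' 0"
      unfolding z_def v1 by (simp add: diff_diff_eq)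
    also note \<xi>(2)
    also have "(\<tau> - 0)\<^sup>2 / 2 * (u'' \<xi> \<bullet> q 1) = \<tau>\<^sup>2 / 2 * (u'' \<xi> \<bullet> q 1)" by simp
    also have "\<dots> \<le> \<tau>\<^sup>2 / 2 * (L\<^sub>2 * norm (q 1))"
    proof (rule mult_left_mono)
      show "u'' \<xi> \<bullet> q 1 \<le> L\<^sub>2 * norm (q 1)"
        using norm_cauchy_schwarz[of "u'' \<xi>" "q 1"] u''_le[OF \<xi>_mem]
        by (meson mult_right_mono norm_ge_zero order_trans)
    qed simp
    also have "\<dots> = \<tau> * L\<^sub>2 / (2 * \<kappa>) * (\<kappa> * \<tau> * norm (q 1))"
      using \<kappa>_pos by (simp add: power2_eq_square)
    also have "\<dots> \<le> \<tau> * L\<^sub>2 / (2 * \<kappa>) * ?s"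
      using q1 \<tau>_pos \<kappa>_pos consts_nonneg by (intro mult_left_mono) auto
    finally have "?s * ?s \<le> \<tau> * L\<^sub>2 / (2 * \<kappa>) * ?s" .
    moreover have "0 \<le> \<tau> * L\<^sub>2 / (2 * \<kappa>)" using \<tau>_pos \<kappa>_pos consts_nonneg by simp
    moreover have "?s \<ge> 0" using P_nonneg by simp
    ultimately have "?s \<le> \<tau> * L\<^sub>2 / (2 * \<kappa>)"
      by (metis mult_right_le_imp_le order_le_less)
    also have "\<dots> \<le> (T powr (1 - \<nu>) * h) * L\<^sub>2 / (2 * \<kappa>)"
      unfolding h_def using \<tau>_le_powr \<kappa>_pos consts_nonneg
      by (intro divide_right_mono mult_right_mono) auto
    finally show ?thesis by (simp only: e1 times_divide_eq_left times_divide_eq_right mult_ac)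
  qed
  \<comment> \<open>With this \<open>c\<close>, the shift \<open>Y * \<kappa> / a * h\<close> is the
    one for which \<open>c\<close> times it equals the consistency contribution
    \<open>2 * \<tau> * Y * h\<close>.\<close>
  define c where "c = 2 * a * \<tau> / \<kappa>"
  have rec: "e (Suc k) \<le> (1 + c) * e k + c * (Y * \<kappa> / a * h)" if k: "1 \<le> k" "k < n" for k
  proof -
    define t where "t = real k * \<tau>"
    define \<gamma> where "\<gamma> = \<tau> * (Y * h + a / \<kappa> * norm (z k))"
    have tk: "real (k - 1) * \<tau> = t - \<tau>" "real (Suc k) * \<tau> = t + \<tau>"
      using k by (simp_all add: t_def of_nat_diff algebra_simps)
    have "real (Suc k) * \<tau> \<le> real n * \<tau>" "0 \<le> real (k - 1) * \<tau>"
      using k \<tau>_pos by (auto intro!: mult_right_mono)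
    then have t: "0 \<le> t - \<tau>" "t + \<tau> \<le> T" using n tk by simp_all
    let ?g = "(z (Suc k) - 2 *\<^sub>R z k + z (k - 1)) + P (2 *\<^sub>R z k - z (k - 1))"
    have z_eqs: "z (Suc k) = u (t + \<tau>) - v (Suc k)" "z k = u t - v k" "z (k - 1) = u (t - \<tau>) - v (k - 1)"
      using tk by (simp_all only: z_def t_def)
    define p p' where "p = P (2 *\<^sub>R u t - u (t - \<tau>))" and "p' = P (2 *\<^sub>R v k - v (k - 1))"
    have "P (2 *\<^sub>R z k - z (k - 1)) = p - p'"
      unfolding z_eqs p_def p'_def linear_diff[OF linear_P, symmetric]
      by (rule arg_cong[of _ _ P]) (simp add: algebra_simps)
    then have "?g = (z (Suc k) - 2 *\<^sub>R z k + z (k - 1)) + (p - p')" by simp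
    also have "\<dots> = (u (t + \<tau>) - 2 *\<^sub>R u t + u (t - \<tau>)) + p - \<tau>\<^sup>2 *\<^sub>R R i (f t - M (v k))"
      using step[OF k] unfolding z_eqs p'_def[symmetric] t_def[symmetric] by (simp add: algebra_simps)
    finally have g: "?g = (u (t + \<tau>) - 2 *\<^sub>R u t + u (t - \<tau>)) + P (2 *\<^sub>R u t - u (t - \<tau>))
        - \<tau>\<^sup>2 *\<^sub>R R i (f t - M (v k))" unfolding p_def .
    have norm_z: "norm (z k) = norm (u t - v k)" by (simp only: z_eqs(2))
    have "?g \<bullet> q (Suc k) \<le> \<gamma> * sqrt (P (q (Suc k)) \<bullet> q (Suc k))"
      unfolding g \<gamma>_def h_def norm_z by (rule residual_bound[OF t])
    moreover have "0 \<le> \<gamma>"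
      unfolding \<gamma>_def h_def using \<tau>_pos Y_nonneg a_pos \<kappa>_pos
      by (intro mult_nonneg_nonneg add_nonneg_nonneg) auto
    ultimately have "e (Suc k) \<le> e k + 2 * \<gamma>"
      unfolding e_def using Pq[of k] Pq[of "Suc k"]
      by (intro dual_energy_step[OF linear_P P_symmetric norm_P_le, of "z k" "z (k - 1)"]) simp_all
    also have "\<gamma> \<le> \<tau> * (Y * h + a / \<kappa> * e k)"
      unfolding \<gamma>_def using z_le \<tau>_pos a_pos \<kappa>_pos by (intro mult_left_mono add_left_mono) auto
    also have "e k + 2 * (\<tau> * (Y * h + a / \<kappa> * e k)) = (1 + c) * e k + c * (Y * \<kappa> / a * h)"
      using a_pos \<kappa>_pos by (simp add: c_def field_simps)
    finally show ?thesis by simp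
  qed
  show ?thesis
  proof (cases "k = 0")
    case True
    then show ?thesis
      using z0 Y_nonneg consts_nonneg \<kappa>_pos a_pos by (simp add: z_def)
  next
    case False
    have "norm (z k) \<le> exp (c * n) * (e 1 + Y * \<kappa> / a * h)"
      using False k e_nonneg Y_nonneg a_pos \<kappa>_pos \<tau>_pos rec
      by (intro order_trans[OF z_le] discrete_Gronwall) (auto simp: c_def h_def)
    also have "\<dots> \<le> exp (c * n) * (L\<^sub>2 * T powr (1 - \<nu>) / (2 * \<kappa>) * h + Y * \<kappa> / a * h)"
      using e1 by simp
    also have "c * n = 2 * a * T / \<kappa>" by (simp add: c_def n[symmetric])
    finally show ?thesis by (simp add: z_def h_def algebra_simps)
  qed
qed

end

section \<open>Choice of constants that do not depend on the step size\<close>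

section \<open>The error estimate for the Cauchy problem\<close>

lemma bounded_below_by_mono: "bounded_below_by \<alpha> D A \<Longrightarrow> \<beta> \<le> \<alpha> \<Longrightarrow> bounded_below_by \<beta> D A"
  unfolding bounded_below_by_def by (meson mult_right_mono order_trans zero_le_power2)

lemma is_operator_sqrt_norm:
  assumes "is_operator_sqrt E B D A" "x \<in> D"
  shows "A x \<bullet> x = (norm (B x))\<^sup>2"
proof -
  have B: "self_adjoint_operator E B" and x: "x \<in> E" "B x \<in> E" and eq: "B (B x) = A x"
    using assms by (auto simp: is_operator_sqrt_def)
  show ?thesis
    using self_adjoint_operatorD(5)[OF B x(2,1)] by (simp add: eq power2_norm_eq_inner)
qed

lemma holder_onE:
  assumes "holder_on \<nu> S w"
  obtains C where "0 \<le> C" "\<And>s t. s \<in> S \<Longrightarrow> t \<in> S \<Longrightarrow> norm (w s - w t) \<le> C * \<bar>s - t\<bar> powr \<nu>"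
proof -
  obtain C where C: "\<And>s t. s \<in> S \<Longrightarrow> t \<in> S \<Longrightarrow> norm (w s - w t) \<le> C * \<bar>s - t\<bar> powr \<nu>"
    using assms by (auto simp: holder_on_def)
  have "norm (w s - w t) \<le> \<bar>C\<bar> * \<bar>s - t\<bar> powr \<nu>" if "s \<in> S" "t \<in> S" for s t
    using C[OF that] mult_right_mono[OF abs_ge_self[of C] powr_ge_zero[of "\<bar>s - t\<bar>" \<nu>]] by linarith
  then show ?thesis using that[of "\<bar>C\<bar>"] by simp
qed

lemma continuous_on_compact_norm_bound:
  fixes w :: "'b::topological_space \<Rightarrow> 'a::real_normed_vector"
  assumes "continuous_on S w" "compact S"
  obtains C where "0 \<le> C" "\<And>t. t \<in> S \<Longrightarrow> norm (w t) \<le> C"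
proof -
  have "bounded (w ` S)" using assms by (intro compact_imp_bounded compact_continuous_image)
  then obtain C where C: "\<forall>x\<in>w ` S. norm x \<le> C" unfolding bounded_iff by blast
  show ?thesis by (rule that[of "max C 0"]) (use C in \<open>auto simp: le_max_iff_disj\<close>)
qed

theorem mainTheorem2:
  fixes D E :: "'a::{real_inner, complete_space} set"
    and A B M :: "'a \<Rightarrow> 'a"
    and m :: nat
    and Ds :: "nat \<Rightarrow> 'a set" and As :: "nat \<Rightarrow> 'a \<Rightarrow> 'a"
    and \<alpha>s \<eta> :: "nat \<Rightarrow> real"
    and \<alpha> a T \<nu> :: real
    and f u :: "real \<Rightarrow> 'a"
    and \<phi>0 \<phi>1 :: 'a
  assumes "self_adjoint_operator D A" and "\<alpha> > 0" and "bounded_below_by \<alpha> D A"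
    and "is_operator_sum D A {1..m} Ds As"
    and "\<And>j. j \<in> {1..m} \<Longrightarrow> self_adjoint_operator (Ds j) (As j)"
    and "\<And>j. j \<in> {1..m} \<Longrightarrow> \<alpha>s j > 0"
    and "\<And>j. j \<in> {1..m} \<Longrightarrow> bounded_below_by (\<alpha>s j) (Ds j) (As j)"
    and "\<And>j. j \<in> {1..m} \<Longrightarrow> 0 < \<eta> j \<and> \<eta> j < 1"
    and "(\<Sum>j = 1..m. \<eta> j) = 1"
    and "a > 0" and "\<And>x y. norm (M x - M y) \<le> a * norm (x - y)"
    and "T > 0" and "continuous_on {0..T} f"
    and "cauchy_solution D A M f T \<phi>0 \<phi>1 u"
    and "is_operator_sqrt E B D A"
    and "0 < \<nu>" and "\<nu> \<le> 1"
    and "holder_on \<nu> {0..T} f"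
    and "holder_on \<nu> {0..T} (\<lambda>t. B (u t))"
  shows "\<exists>c>0. \<forall>n>1. \<forall>v y. decomposition_scheme m Ds As \<eta> M f T \<phi>0 \<phi>1 n v y \<longrightarrow>
           (\<forall>k\<le>n. norm (u (real k * (T / real n)) - v k) \<le> c * (T / real n) powr \<nu>)"
proof -
  let ?J = "{1..m}"
  \<comment> \<open>Weights summing to 1 exclude \<open>m = 0\<close>, so the component carrying the
    source exists.\<close>
  have m: "1 \<in> ?J" using assms(9) by (cases m) auto
  have D: "D = (\<Inter>j\<in>?J. Ds j)" and A_sum: "\<And>x. x \<in> D \<Longrightarrow> A x = (\<Sum>j\<in>?J. As j x)"
    using assms(4) by (auto simp: is_operator_sum_def)
  have As_nonneg: "bounded_below_by 0 (Ds j) (As j)" if "j \<in> ?J" for j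
    using bounded_below_by_mono[OF assms(7)[OF that]] assms(6)[OF that] by simp
  obtain u' u'' where u: "\<And>t. t \<in> {0..T} \<Longrightarrow> (u has_vector_derivative u' t) (at t within {0..T})"
    "\<And>t. t \<in> {0..T} \<Longrightarrow> (u' has_vector_derivative u'' t) (at t within {0..T})"
    "continuous_on {0..T} u''" "\<And>t. t \<in> {0..T} \<Longrightarrow> u t \<in> D" "continuous_on {0..T} (\<lambda>t. A (u t))"
    "\<And>t. t \<in> {0..T} \<Longrightarrow> u'' t + A (u t) + M (u t) = f t" "u 0 = \<phi>0" "u' 0 = \<phi>1"
    using assms(14) unfolding cauchy_solution_def by blast
  have "continuous_on {0..T} u'" using u(2) by (rule continuous_on_vector_derivative)
  then obtain L\<^sub>1 where L\<^sub>1: "\<And>t. t \<in> {0..T} \<Longrightarrow> norm (u' t) \<le> L\<^sub>1"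
    using continuous_on_compact_norm_bound[OF _ compact_Icc] by metis
  obtain L\<^sub>2 where L\<^sub>2: "\<And>t. t \<in> {0..T} \<Longrightarrow> norm (u'' t) \<le> L\<^sub>2"
    using continuous_on_compact_norm_bound[OF u(3) compact_Icc] by metis
  obtain K\<^sub>A where K\<^sub>A: "0 \<le> K\<^sub>A" "\<And>t. t \<in> {0..T} \<Longrightarrow> norm (A (u t)) \<le> K\<^sub>A"
    using continuous_on_compact_norm_bound[OF u(5) compact_Icc] by metis
  \<comment> \<open>The equation expresses \<open>f - M u\<close> through \<open>u''\<close> and
    \<open>A u\<close>, both bounded already.\<close>
  have K': "norm (f t - M (u t)) \<le> L\<^sub>2 + K\<^sub>A" if t: "t \<in> {0..T}" for t
  proof -
    have "f t - M (u t) = u'' t + A (u t)" using u(6)[OF t] by (simp add: algebra_simps)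
    then show ?thesis using norm_triangle_mono[OF L\<^sub>2[OF t] K\<^sub>A(2)[OF t]] by simp
  qed
  \<comment> \<open>Relative boundedness turns the bound on \<open>A (u t)\<close> into bounds on
    each \<open>As j (u t)\<close>, whose continuity is not assumed.\<close>
  have "\<exists>C\<ge>0. \<forall>x\<in>D. norm (As j x) \<le> C * norm (A x)" if j: "j \<in> ?J" for j
    using j D by (intro self_adjoint_operator_relatively_bounded[OF assms(1-3) assms(5)[OF j]]) auto
  then obtain C where C: "\<And>j. j \<in> ?J \<Longrightarrow> 0 \<le> C j"
    "\<And>j x. j \<in> ?J \<Longrightarrow> x \<in> D \<Longrightarrow> norm (As j x) \<le> C j * norm (A x)" by metis
  define K where "K = (\<Sum>j\<in>?J. C j) * K\<^sub>A"
  have K: "norm (As j (u t)) \<le> K" if "t \<in> {0..T}" "j \<in> ?J" for t j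
  proof -
    have "norm (As j (u t)) \<le> C j * norm (A (u t))" using C(2) u(4) that by blast
    also have "\<dots> \<le> (\<Sum>j\<in>?J. C j) * K\<^sub>A"
      using C(1) K\<^sub>A that by (intro mult_mono member_le_sum sum_nonneg) auto
    finally show ?thesis by (simp add: K_def)
  qed
  obtain C\<^sub>f where C\<^sub>f: "0 \<le> C\<^sub>f"
    "\<And>s t. s \<in> {0..T} \<Longrightarrow> t \<in> {0..T} \<Longrightarrow> norm (f s - f t) \<le> C\<^sub>f * \<bar>s - t\<bar> powr \<nu>"
    using holder_onE[OF assms(18)] by metis
  obtain C\<^sub>B where C\<^sub>B: "0 \<le> C\<^sub>B"
    "\<And>s t. s \<in> {0..T} \<Longrightarrow> t \<in> {0..T} \<Longrightarrow> norm (B (u s) - B (u t)) \<le> C\<^sub>B * \<bar>s - t\<bar> powr \<nu>"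
    using holder_onE[OF assms(19)] by metis
  \<comment> \<open>Since \<open>\<tau> \<le> T\<close>, this makes
    \<open>\<mu> * \<tau>\<^sup>2\<close> meet both upper bounds required by
    \<open>P_coercive\<close>; \<open>\<kappa>\<close> is then chosen so that
    \<open>(\<kappa> * \<tau>)\<^sup>2\<close> is the resulting lower bound for
    \<open>P\<close>.\<close>
  define \<mu> where "\<mu> = min (\<alpha>s 1 / \<eta> 1) (1 / T\<^sup>2)"
  have \<eta>1: "\<eta> 1 > 0" using assms(8)[OF m] by simp
  have \<mu>: "\<mu> > 0" using \<eta>1 assms(6)[OF m] assms(12) by (simp add: \<mu>_def)
  define \<kappa> where "\<kappa> = sqrt (\<eta> 1 * \<mu> / 2)"
  \<comment> \<open>The value that \<open>Y\<close> takes once a step size is fixed, written out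
    beforehand so that \<open>c\<close> is independent of \<open>n\<close>.\<close>
  define Y\<^sub>0 where "Y\<^sub>0 = 2 * C\<^sub>B + T powr (1 - \<nu>) * (K * (\<Sum>j\<in>?J. 1 / sqrt (\<eta> j)) + (L\<^sub>2 + K\<^sub>A) / sqrt (\<eta> 1))
     + (C\<^sub>f + a * L\<^sub>1 * T powr (1 - \<nu>)) / \<kappa>"
  define c where "c = exp (2 * a * T / \<kappa>) * (L\<^sub>2 * T powr (1 - \<nu>) / (2 * \<kappa>) + Y\<^sub>0 * \<kappa> / a)"
  have main: "norm (u (real k * (T / real n)) - v k) \<le> max 1 c * (T / real n) powr \<nu>"
    if n: "n > 1" and k: "k \<le> n"
      and scheme: "decomposition_scheme m Ds As \<eta> M f T \<phi>0 \<phi>1 n v y" for n v y k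
  proof -
    define \<tau> where "\<tau> = T / real n"
    have \<tau>: "\<tau> > 0" "\<tau> \<le> T" "real n * \<tau> = T"
      using n assms(12) by (auto simp: \<tau>_def field_simps)
    have "\<exists>x\<in>Ds j. x + (\<tau>\<^sup>2 / \<eta> j) *\<^sub>R As j x = z" if j: "j \<in> ?J" for j z
      using assms(8)[OF j] \<tau>(1) by (intro nonneg_resolvent_exists[OF assms(5)[OF j] As_nonneg[OF j]]) simp
    then obtain R where R: "\<And>j z. j \<in> ?J \<Longrightarrow> R j z \<in> Ds j"
      "\<And>j z. j \<in> ?J \<Longrightarrow> R j z + (\<tau>\<^sup>2 / \<eta> j) *\<^sub>R As j (R j z) = z" by metis
    interpret resolvent_splitting ?J Ds As R \<eta> \<tau>
    proof (rule resolvent_splitting.intro)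
      fix j assume j: "j \<in> ?J"
      show "nonneg_resolvent (Ds j) (As j) (\<tau>\<^sup>2 / \<eta> j) (R j)"
        using j R assms(5,8) As_nonneg \<tau>(1) by unfold_locales auto
    qed (use assms(8,9) \<tau>(1) in auto)
    have lower: "(\<kappa> * \<tau>)\<^sup>2 * (norm x)\<^sup>2 \<le> P x \<bullet> x" for x
    proof -
      have "\<mu> * \<tau>\<^sup>2 \<le> (\<alpha>s 1 / \<eta> 1) * \<tau>\<^sup>2" by (intro mult_right_mono) (simp_all add: \<mu>_def)
      moreover have "\<mu> * \<tau>\<^sup>2 \<le> (1 / T\<^sup>2) * T\<^sup>2"
      proof (rule mult_mono)
        show "\<mu> \<le> 1 / T\<^sup>2" by (simp add: \<mu>_def)
        show "\<tau>\<^sup>2 \<le> T\<^sup>2" using \<tau> by (intro power_mono) auto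
      qed simp_all
      ultimately have "\<eta> 1 * (\<mu> * \<tau>\<^sup>2) / 2 * (norm x)\<^sup>2 \<le> P x \<bullet> x"
        using \<mu> assms(12) by (intro P_coercive[OF m assms(7)[OF m]]) (auto simp: mult.commute)
      moreover have "(\<kappa> * \<tau>)\<^sup>2 = \<eta> 1 * (\<mu> * \<tau>\<^sup>2) / 2"
        using \<eta>1 \<mu> by (simp add: \<kappa>_def power_mult_distrib)
      ultimately show ?thesis by (simp only:)
    qed
    have B: "self_adjoint_operator E B" using assms(15) by (simp add: is_operator_sqrt_def)
    have DE: "D \<subseteq> E" using assms(15) unfolding is_operator_sqrt_def by blast
    have mem_D: "x \<in> D" if "\<And>j. j \<in> ?J \<Longrightarrow> x \<in> Ds j" for x using that unfolding D by blast
    interpret splitting_error ?J Ds As R \<eta> \<tau> 1 B M f u u' u'' T \<nu> \<kappa> a C\<^sub>B C\<^sub>f L\<^sub>1 L\<^sub>2 K "L\<^sub>2 + K\<^sub>A"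
    proof (intro splitting_error.intro splitting_error_axioms.intro)
      show "resolvent_splitting ?J Ds As R \<eta> \<tau>" by (rule resolvent_splitting_axioms)
      fix x y
      assume x: "\<And>j. j \<in> ?J \<Longrightarrow> x \<in> Ds j"
      show "(\<Sum>j\<in>?J. As j x) \<bullet> x = (norm (B x))\<^sup>2"
        using is_operator_sqrt_norm[OF assms(15) mem_D[OF x]] A_sum[OF mem_D[OF x]] by simp
      assume y: "\<And>j. j \<in> ?J \<Longrightarrow> y \<in> Ds j"
      have xy: "x \<in> E" "y \<in> E" using mem_D[OF x] mem_D[OF y] DE by auto
      show "B (x + y) = B x + B y" by (rule self_adjoint_operatorD(3)[OF B xy])
      show "B (x - y) = B x - B y" by (rule self_adjoint_operator_diff(2)[OF B xy])
    next
      fix t assume t: "t \<in> {0..T}"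
      show "u'' t + (\<Sum>j\<in>?J. As j (u t)) + M (u t) = f t"
        using u(6)[OF t] A_sum[OF u(4)[OF t]] by simp
      show "u t \<in> Ds j" if "j \<in> ?J" for j using u(4)[OF t] that unfolding D by blast
      show "norm (As j (u t)) \<le> K" if "j \<in> ?J" for j using K[OF t that] .
      show "norm (u' t) \<le> L\<^sub>1" "norm (u'' t) \<le> L\<^sub>2" "norm (f t - M (u t)) \<le> L\<^sub>2 + K\<^sub>A"
        using L\<^sub>1[OF t] L\<^sub>2[OF t] K'[OF t] .
      show "(u has_vector_derivative u' t) (at t within {0..T})"
        "(u' has_vector_derivative u'' t) (at t within {0..T})" using u(1,2)[OF t] .
      fix s assume s: "s \<in> {0..T}"
      show "norm (B (u s) - B (u t)) \<le> C\<^sub>B * \<bar>s - t\<bar> powr \<nu>"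
        "norm (f s - f t) \<le> C\<^sub>f * \<bar>s - t\<bar> powr \<nu>"
        using C\<^sub>B(2)[OF s t] C\<^sub>f(2)[OF s t] .
    next
      show "0 < \<kappa>" using \<eta>1 \<mu> by (simp add: \<kappa>_def)
    qed (fact m lower \<tau>(2) assms(10) assms(11) assms(16) assms(17) C\<^sub>B(1) C\<^sub>f(1))+
    note sch = scheme[unfolded decomposition_scheme_def Let_def, folded \<tau>_def]
    have "norm (u (real k * \<tau>) - v k) \<le>
        exp (2 * a * T / \<kappa>) * (L\<^sub>2 * T powr (1 - \<nu>) / (2 * \<kappa>) + Y * \<kappa> / a) * \<tau> powr \<nu>"
    proof (rule error_bound[OF \<tau>(3) _ _ _ k])
      show "v 0 = u 0" "v 1 = u 0 + \<tau> *\<^sub>R u' 0" unfolding u(7,8) using sch by blast+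
      fix k assume k: "1 \<le> k" "k < n"
      then have k': "k \<in> {1..n - 1}" by auto
      have y: "y j (k + 1) \<in> Ds j"
        and eq: "\<eta> j *\<^sub>R ((y j (k + 1) - 2 *\<^sub>R v k + v (k - 1)) /\<^sub>R \<tau>\<^sup>2) +
          As j (y j (k + 1)) = (if j = 1 then f (real k * \<tau>) - M (v k) else 0)" if "j \<in> ?J" for j
        using sch k' that by blast+
      have eq': "\<eta> j *\<^sub>R ((y j (k + 1) - (2 *\<^sub>R v k - v (k - 1))) /\<^sub>R \<tau>\<^sup>2) +
          As j (y j (k + 1)) = (if j = 1 then f (real k * \<tau>) - M (v k) else 0)" if "j \<in> ?J" for j
        using eq[OF that] unfolding diff_diff_eq2 by (simp only: diff_add_eq)
      have "v (k + 1) = (\<Sum>j\<in>?J. \<eta> j *\<^sub>R y j (k + 1))" using sch k' by blast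
      also have "\<dots> = (2 *\<^sub>R v k - v (k - 1)) - P (2 *\<^sub>R v k - v (k - 1))
          + \<tau>\<^sup>2 *\<^sub>R R 1 (f (real k * \<tau>) - M (v k))"
        by (rule scheme_value[OF m y eq'])
      finally show "v (Suc k) = (2 *\<^sub>R v k - v (k - 1)) - P (2 *\<^sub>R v k - v (k - 1))
          + \<tau>\<^sup>2 *\<^sub>R R 1 (f (real k * \<tau>) - M (v k))" by (simp only: Suc_eq_plus1)
    qed
    also have "\<dots> = c * \<tau> powr \<nu>" by (simp only: c_def Y_def Y\<^sub>0_def)
    also have "\<dots> \<le> max 1 c * \<tau> powr \<nu>" by (intro mult_right_mono) auto
    finally show ?thesis by (simp add: \<tau>_def)
  qed
  show ?thesis
  proof (intro exI[of _ "max 1 c"] conjI allI impI)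
    show "0 < max 1 c" by simp
  qed (rule main)
qed

end
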